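(* Let $\lambda\in\mathbb{R}$ and let $H_0:\mathbb{R}^n\times[0,T]\times\mathbb{R}^n\to\mathbb{R}$ be continuous and satisfy: $|H_0(x,t,p)-H_0(y,t,p)|\le C_1(\beta+|p|)|x-y|$ ($C_1\ge0$, $\beta\in\{0,1\}$); $|H_0(x,t,p)-H_0(x,t,q)|\le(A_2|x|+B_2)|p-q|$ ($A_2,B_2\ge0$); $p\mapsto H_0(x,t,p)$ convex. Let $u\in C(\mathbb{R}^n\times[0,T))$ be a viscosity solution of $u_t+\lambda u+H_0(x,t,D_xu)=0$ in $\mathbb{R}^n\times(0,T)$, $u(x,0)=u_0(x)$. Then for all $(x,t)\in\mathbb{R}^n\times(0,T)$ and $p\in D_x^-u(x,t)$: (i) if $\lambda\ne-C_1$, $|p|\ge\underline{I}(x,t;u_0)e^{-(C_1+\lambda)t}-\frac{C_1\beta}{C_1+\lambda}(1-e^{-(C_1+\lambda)t})$; (ii) if $\lambda=-C_1$, $|p|\ge\underline{I}(x,t;u_0)-C_1\beta t$.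
   Context: $T>0$, $u_0:\mathbb{R}^n\to\mathbb{R}$ Lipschitz. Viscosity solution: $u\in C(\mathbb{R}^n\times[0,T))$ with $u(\cdot,0)=u_0$ such that for every $\phi\in C^1(\mathbb{R}^n\times(0,T))$, if $u-\phi$ has a local max (resp. min) at $(x,t)\in\mathbb{R}^n\times(0,T)$ then $\phi_t+\lambda u(x,t)+H_0(x,t,D_x\phi(x,t))\le0$ (resp. $\ge0$). $D^-f(x)=\{D\phi(x):\phi\in C^1,\ f-\phi$ has a local min at $x\}$; $D_x^-u(x,t)=\{p:(p,\tau)\in D^-u(x,t)\}$. $R(x,t)=(\frac{B_2}{A_2}+|x|)(e^{A_2t}-1)$ if $A_2>0$, $=B_2t$ if $A_2=0$. $\underline{I}(x,t;u_0)=\lim_{\delta\to0^+}\inf\{|p|:p\in D^-u_0(y),\ y\in\overline{B_{R(x,t)+\delta}(x)}\}$. *)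

theory Defs
  imports "HOL-Analysis.Analysis"
begin

definition C1_with_grad :: "'b::euclidean_space set \<Rightarrow> ('b \<Rightarrow> real) \<Rightarrow> ('b \<Rightarrow> 'b) \<Rightarrow> bool" where
  "C1_with_grad S \<phi> g \<longleftrightarrow>
     (\<forall>z\<in>S. (\<phi> has_derivative (\<lambda>h. g z \<bullet> h)) (at z)) \<and> continuous_on S g"

definition subdiff :: "('b::euclidean_space \<Rightarrow> real) \<Rightarrow> 'b \<Rightarrow> 'b set" where
  "subdiff f z = {g z | \<phi> g. C1_with_grad UNIV \<phi> g \<and>
      (\<exists>e>0. \<forall>w. dist w z < e \<longrightarrow> f z - \<phi> z \<le> f w - \<phi> w)}"

definition subdiff_x :: "('a::euclidean_space \<Rightarrow> real \<Rightarrow> real) \<Rightarrow> 'a \<Rightarrow> real \<Rightarrow> 'a set" where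
  "subdiff_x u x t = {p. \<exists>\<tau>. (p, \<tau>) \<in> subdiff (\<lambda>(y, s). u y s) (x, t)}"

definition Rfun :: "real \<Rightarrow> real \<Rightarrow> 'a::euclidean_space \<Rightarrow> real \<Rightarrow> real" where
  "Rfun A2 B2 x t = (if A2 > 0 then (B2 / A2 + norm x) * (exp (A2 * t) - 1) else B2 * t)"

text \<open>Lower quantity I(x,t;u0); infima taken in the extended reals (Inf of empty set = +infinity).\<close>
definition I_lower :: "real \<Rightarrow> real \<Rightarrow> 'a::euclidean_space \<Rightarrow> real \<Rightarrow> ('a \<Rightarrow> real) \<Rightarrow> ereal" where
  "I_lower A2 B2 x t u0 = Lim (at_right 0)
     (\<lambda>\<delta>. INF y\<in>cball x (Rfun A2 B2 x t + \<delta>). INF p\<in>subdiff u0 y. ereal (norm p))"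

definition viscosity_solution ::
  "real \<Rightarrow> real \<Rightarrow> ('a::euclidean_space \<Rightarrow> real \<Rightarrow> 'a \<Rightarrow> real) \<Rightarrow> ('a \<Rightarrow> real) \<Rightarrow> ('a \<Rightarrow> real \<Rightarrow> real) \<Rightarrow> bool" where
  "viscosity_solution T lam H0 u0 u \<longleftrightarrow>
     continuous_on (UNIV \<times> {0..<T}) (\<lambda>(x, t). u x t) \<and>
     (\<forall>x. u x 0 = u0 x) \<and>
     (\<forall>\<phi> g x t. C1_with_grad (UNIV \<times> {0<..<T}) \<phi> g \<and> 0 < t \<and> t < T \<longrightarrow>
        ((\<exists>e>0. \<forall>y s. dist (y, s) (x, t) < e \<and> 0 < s \<and> s < T \<longrightarrow>
              u y s - \<phi> (y, s) \<le> u x t - \<phi> (x, t))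
          \<longrightarrow> snd (g (x, t)) + lam * u x t + H0 x t (fst (g (x, t))) \<le> 0) \<and>
        ((\<exists>e>0. \<forall>y s. dist (y, s) (x, t) < e \<and> 0 < s \<and> s < T \<longrightarrow>
              u x t - \<phi> (x, t) \<le> u y s - \<phi> (y, s))
          \<longrightarrow> snd (g (x, t)) + lam * u x t + H0 x t (fst (g (x, t))) \<ge> 0))"

end

(* After replacing u by e^(lam t) u the zero-order term disappears and beta becomes beta e^(lam t).

   A lower bound eta on the subgradients of u0 near x says that u0 drops by at least eta r inside every
   small ball of radius r. This property is propagated in time: with r(t) = r0 e^(C1 t) and a suitable c
   with c(0) = eta r0, the function w(x,t) = inf over |y - x| <= r(t) of u(y,t), plus c(t), is again a
   viscosity subsolution, so w <= u by comparison on the cone of dependence, and c(t)/r(t) is the asserted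
   bound for the slope of u(.,t).

   An infimum of subsolutions is a subsolution only because H is convex in p. Here this is used through
   affine minorants of H(y,t,.): a Lipschitz subsolution grows at most at the rate -a along a segment with
   velocity v whenever a + v.q <= H(y,t,q) for all q, and an affine minorant at x can be moved to one at y
   at the cost C1 |x - y| in v and C1 beta |x - y| in a, which is exactly what the growth of r and the
   choice of c pay for. *)
theory Submission
  imports Defs
begin

subsection \<open>Viscosity sub- and supersolutions\<close>

text \<open>The obstacle is the moving infimum. If w - phi has a maximum at (x,t) and y realises the
  infimum there, no test function touches u from above at y, since the infimum bounds u only from
  below. So the subsolution property of u is used in integrated form, along short segments that
  start at minimisers of earlier times. There H is controlled only by its continuity, hence
  uniformly only for bounded momenta, and this calls for a Lipschitz bound on u(.,t). That bound is
  not a hypothesis: it comes from the dual device, a supremum of u over shrinking balls, where a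
  maximiser does yield a test function and convexity plays no part. Both devices rest on comparison
  inside a backward cone, whose speed A|x| + B grows with |x|; this is the source of the exponential
  in R. The enlargement \<delta> of the initial ball is spent in two halves: one leaves room for a
  smooth barrier around the cone, the other for the balls of radius r0 over which u0 has to
  drop.\<close>

definition viscosity_sub ::
  "real \<Rightarrow> ('a::euclidean_space \<Rightarrow> real \<Rightarrow> 'a \<Rightarrow> real) \<Rightarrow> ('a \<Rightarrow> real \<Rightarrow> real) \<Rightarrow> bool" where
  "viscosity_sub T H w \<longleftrightarrow>
     (\<forall>\<phi> g x t. C1_with_grad (UNIV \<times> {0<..<T}) \<phi> g \<longrightarrow> 0 < t \<longrightarrow> t < T \<longrightarrow>
        (\<exists>e>0. \<forall>y s. dist (y, s) (x, t) < e \<and> 0 < s \<and> s < T \<longrightarrow>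
              w y s - \<phi> (y, s) \<le> w x t - \<phi> (x, t))
          \<longrightarrow> snd (g (x, t)) + H x t (fst (g (x, t))) \<le> 0)"

definition viscosity_super ::
  "real \<Rightarrow> ('a::euclidean_space \<Rightarrow> real \<Rightarrow> 'a \<Rightarrow> real) \<Rightarrow> ('a \<Rightarrow> real \<Rightarrow> real) \<Rightarrow> bool" where
  "viscosity_super T H w \<longleftrightarrow>
     (\<forall>\<phi> g x t. C1_with_grad (UNIV \<times> {0<..<T}) \<phi> g \<longrightarrow> 0 < t \<longrightarrow> t < T \<longrightarrow>
        (\<exists>e>0. \<forall>y s. dist (y, s) (x, t) < e \<and> 0 < s \<and> s < T \<longrightarrow>
              w x t - \<phi> (x, t) \<le> w y s - \<phi> (y, s))
          \<longrightarrow> snd (g (x, t)) + H x t (fst (g (x, t))) \<ge> 0)"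

section \<open>Test functions of class C1 and exponential rates\<close>

lemma C1_with_grad_subset: "C1_with_grad S \<phi> g \<Longrightarrow> S' \<subseteq> S \<Longrightarrow> C1_with_grad S' \<phi> g"
  unfolding C1_with_grad_def by (meson continuous_on_subset subsetD)

lemma C1_with_grad_add:
  "C1_with_grad S \<phi> g \<Longrightarrow> C1_with_grad S \<psi> k \<Longrightarrow> C1_with_grad S (\<lambda>z. \<phi> z + \<psi> z) (\<lambda>z. g z + k z)"
  unfolding C1_with_grad_def
  by (auto intro!: continuous_intros derivative_eq_intros simp: inner_add_left)

lemma C1_with_grad_minus: "C1_with_grad S \<phi> g \<Longrightarrow> C1_with_grad S (\<lambda>z. - \<phi> z) (\<lambda>z. - g z)"
  unfolding C1_with_grad_def
  by (auto intro!: continuous_intros derivative_eq_intros)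

lemma C1_with_grad_quadratic:
  fixes y :: "'a::euclidean_space"
  shows "C1_with_grad S (\<lambda>z. a * (norm (fst z - y))\<^sup>2 + b * (snd z - s)\<^sup>2)
          (\<lambda>z. ((2 * a) *\<^sub>R (fst z - y), 2 * b * (snd z - s)))"
  unfolding C1_with_grad_def power2_norm_eq_inner
  by (auto intro!: continuous_intros derivative_eq_intros ext
      simp: algebra_simps inner_commute power2_eq_square split: prod.splits)

text \<open>The distance to \<open>x\<close> is not differentiable at \<open>x\<close>; this
  smoothing is, and its gradient has norm below 1. It serves both in the cone barrier and in the
  descent argument for u0.\<close>

lemma C1_with_grad_smooth_norm:
  fixes x :: "'a::euclidean_space"
  assumes "e > 0"
  shows "C1_with_grad UNIV (\<lambda>y. sqrt (inner (y - x) (y - x) + e\<^sup>2))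
      (\<lambda>y. (1 / sqrt (inner (y - x) (y - x) + e\<^sup>2)) *\<^sub>R (y - x))"
proof -
  have pos: "inner (y - x) (y - x) + e\<^sup>2 > 0" for y
    using assms by (simp add: add_nonneg_pos)
  have "((\<lambda>y. sqrt (inner (y - x) (y - x) + e\<^sup>2)) has_derivative
      (\<lambda>h. inner ((1 / sqrt (inner (y - x) (y - x) + e\<^sup>2)) *\<^sub>R (y - x)) h)) (at y)" for y
    using pos[of y] by (auto intro!: derivative_eq_intros ext simp: inner_commute divide_simps)
  moreover have "continuous_on UNIV (\<lambda>y. (1 / sqrt (inner (y - x) (y - x) + e\<^sup>2)) *\<^sub>R (y - x))"
    using pos by (intro continuous_intros) (metis real_sqrt_eq_zero_cancel_iff less_irrefl)
  ultimately show ?thesis by (simp add: C1_with_grad_def)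
qed

text \<open>One rate \<open>k\<close> makes an exponential barrier negligible at distance \<kappa>
  below its threshold and at least \<open>M\<close> at distance \<kappa> above it.\<close>

lemma exp_rate:
  fixes \<kappa> \<sigma> M :: real
  assumes "\<kappa> > 0" "\<sigma> > 0"
  obtains k where "k > 0" "exp (- (k * \<kappa>)) < \<sigma>" "M \<le> exp (k * \<kappa>)"
proof -
  define k where "k = max 1 (max (ln (max 1 M)) (1 - ln \<sigma>) / \<kappa>)"
  have k\<kappa>: "k * \<kappa> \<ge> max (ln (max 1 M)) (1 - ln \<sigma>)"
    using assms by (simp add: k_def field_simps max_def)
  show ?thesis
  proof (rule that[of k])
    show "k > 0" by (simp add: k_def)
    have "exp (- (k * \<kappa>)) < exp (ln \<sigma>)" using k\<kappa> by (subst exp_less_cancel_iff) simp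
    then show "exp (- (k * \<kappa>)) < \<sigma>" using assms by simp
    have "exp (ln (max 1 M)) \<le> exp (k * \<kappa>)" using k\<kappa> by (subst exp_le_cancel_iff) simp
    then show "M \<le> exp (k * \<kappa>)" by simp
  qed
qed

subsection \<open>The cone of dependence\<close>

lemma Rfun_nonneg: "A \<ge> 0 \<Longrightarrow> B \<ge> 0 \<Longrightarrow> t \<ge> 0 \<Longrightarrow> Rfun A B x t \<ge> 0"
  by (simp add: Rfun_def)

text \<open>\<open>Rfun\<close> solves R' = A (|x| + R) + B with R(0) = 0: it is the distance from x
  reached when moving outwards at the greatest speed A|y| + B. The formula for the derivative covers
  A = 0 as well.\<close>

lemma DERIV_Rfun:
  assumes "A \<ge> 0"
  shows "((\<lambda>s. Rfun A B x s) has_real_derivative (A * norm x + B) * exp (A * s)) (at s)"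
proof (cases "A > 0")
  case True
  then have "(\<lambda>s. Rfun A B x s) = (\<lambda>s. (B / A + norm x) * (exp (A * s) - 1))"
    by (simp add: Rfun_def)
  with True show ?thesis
    by (auto intro!: derivative_eq_intros simp: field_simps)
next
  case False
  then have "A = 0" "(\<lambda>s. Rfun A B x s) = (\<lambda>s. B * s)"
    using assms by (auto simp: Rfun_def)
  then show ?thesis
    by (auto intro!: derivative_eq_intros)
qed

text \<open>The function D(x,s) = e^(A s) q(x) + R(s), with q a smoothed distance to x0, satisfies
  D_s \<ge> (A|x| + B) |D_x|, because |x| \<le> q(x) + |x0| and |q_x| \<le> 1. Its sublevel sets are
  cones shrinking in time. Any increasing function of D keeps the inequality; an exponential makes
  the barrier small at (x0,t0) and large outside the cone. A second exponential in time alone closes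
  the cone at t1 and provides the strict margin \<mu>.\<close>

lemma cone_barrier:
  fixes x0 :: "'a::euclidean_space"
  assumes A: "A \<ge> 0" and B: "B \<ge> 0" and \<delta>: "\<delta> > 0" and \<sigma>: "\<sigma> > 0" and t: "t0 < t1"
  obtains \<zeta> :: "'a \<times> real \<Rightarrow> real" and g \<mu> where
    "\<mu> > 0" "C1_with_grad UNIV \<zeta> g" "\<zeta> (x0, t0) < \<sigma>" "\<And>z. \<zeta> z \<ge> 0"
    "\<And>x s. 0 \<le> s \<Longrightarrow> Rfun A B x0 t0 + \<delta> \<le> dist x x0 \<Longrightarrow> M \<le> \<zeta> (x, s)"
    "\<And>x s. t1 \<le> s \<Longrightarrow> M \<le> \<zeta> (x, s)"
    "\<And>x s. 0 \<le> s \<Longrightarrow> s \<le> t1 \<Longrightarrow> (A * norm x + B) * norm (fst (g (x, s))) + \<mu> \<le> snd (g (x, s))"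
proof -
  define \<kappa> where "\<kappa> = min (\<delta> / 4) ((t1 - t0) / 2)"
  define ts where "ts = (t0 + t1) / 2"
  \<comment> \<open>This smoothing makes e^(A t0) q(x0) equal to \<delta>/4, so that D(x0,t0) =
    \<rho> - \<delta>/4, whereas D \<ge> \<rho> + \<delta>/2 at distance at least R + \<delta> from
    x0.\<close>
  define e where "e = \<delta> / 4 * exp (- A * t0)"
  define \<rho> where "\<rho> = Rfun A B x0 t0 + \<delta> / 2"
  have \<kappa>: "\<kappa> > 0" using \<delta> t by (simp add: \<kappa>_def)
  have \<kappa>le: "\<kappa> \<le> \<delta> / 4" "\<kappa> \<le> (t1 - t0) / 2"
    unfolding \<kappa>_def by (rule min.cobounded1, rule min.cobounded2)
  have e: "e > 0" using \<delta> by (simp add: e_def)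
  obtain k where k: "k > 0" and k\<sigma>: "exp (- (k * \<kappa>)) < \<sigma> / 2" and kM: "M \<le> exp (k * \<kappa>)"
    using exp_rate[OF \<kappa>, of "\<sigma> / 2" M] \<sigma> by auto
  define q where "q x = sqrt (inner (x - x0) (x - x0) + e\<^sup>2)" for x
  have qpos: "inner (x - x0) (x - x0) + e\<^sup>2 > 0" for x
    using e by (simp add: add_nonneg_pos)
  have qn: "norm (x - x0) \<le> q x" for x
    by (simp add: q_def norm_eq_sqrt_inner)
  have qp: "q x > 0" for x using qpos by (simp add: q_def)
  define D where "D z = exp (A * snd z) * q (fst z) + Rfun A B x0 (snd z)" for z
  define \<zeta> where "\<zeta> z = exp (k * (D z - \<rho>)) + exp (k * (snd z - ts))" for z
  define E where "E z = k * exp (k * (D z - \<rho>)) * exp (A * snd z)" for z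
  define g where "g z = ((E z / q (fst z)) *\<^sub>R (fst z - x0),
      E z * (A * q (fst z) + (A * norm x0 + B)) + k * exp (k * (snd z - ts)))" for z
  have E: "E z > 0" for z using k by (simp add: E_def)
  have qd: "(q has_derivative (\<lambda>h. inner ((1 / q x) *\<^sub>R (x - x0)) h)) (at x)" for x
    using C1_with_grad_smooth_norm[OF e, of x0] by (simp add: C1_with_grad_def q_def[abs_def])
  have qf: "((\<lambda>z. q (fst z)) has_derivative (\<lambda>h. inner (fst z - x0) (fst h) / q (fst z))) (at z)" for z :: "'a \<times> real"
    using has_derivative_compose[OF has_derivative_fst[OF has_derivative_ident] qd[of "fst z"]] by simp
  have Rf: "((\<lambda>z. Rfun A B x0 (snd z)) has_derivative (\<lambda>h. (A * norm x0 + B) * exp (A * snd z) * snd h)) (at z)" for z :: "'a \<times> real"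
    by (rule has_derivative_compose[where g="Rfun A B x0" and f=snd, unfolded o_def])
       (use DERIV_Rfun[OF A, of B x0] in \<open>auto intro!: derivative_eq_intros simp: has_field_derivative_def\<close>)
  have der: "(\<zeta> has_derivative (\<lambda>h. inner (g z) h)) (at z)" for z
    unfolding \<zeta>_def[abs_def] D_def[abs_def]
    apply (rule derivative_eq_intros qf Rf refl | simp)+
    apply (rule ext)
    subgoal for h
      using qp[of "fst z"] by (cases h) (simp add: g_def E_def D_def, simp add: field_simps)
    done
  have cq: "continuous_on UNIV (\<lambda>z::'a\<times>real. q (fst z))"
    using qf by (meson UNIV_I continuous_at_imp_continuous_on has_derivative_continuous)
  have cR: "continuous_on UNIV (\<lambda>z::'a\<times>real. Rfun A B x0 (snd z))"
    using Rf by (meson UNIV_I continuous_at_imp_continuous_on has_derivative_continuous)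
  have "continuous_on UNIV g"
    unfolding g_def[abs_def] E_def D_def using qp
    by (intro continuous_intros cq cR) (metis less_irrefl)
  then have C1: "C1_with_grad UNIV \<zeta> g"
    using der by (simp add: C1_with_grad_def)
  have D0: "D (x0, t0) = \<rho> - \<delta> / 4"
  proof -
    have "q x0 = e" using e by (simp add: q_def)
    then show ?thesis by (simp add: D_def e_def \<rho>_def exp_minus field_simps)
  qed
  have a: "\<zeta> (x0, t0) < \<sigma>"
  proof -
    have "k * (D (x0, t0) - \<rho>) \<le> - (k * \<kappa>)" "k * (t0 - ts) \<le> - (k * \<kappa>)"
      using k mult_left_mono[OF \<kappa>le(1), of k] mult_left_mono[OF \<kappa>le(2), of k]
      by (auto simp: D0 ts_def field_simps)
    then have "exp (k * (D (x0, t0) - \<rho>)) \<le> exp (- (k * \<kappa>))" "exp (k * (t0 - ts)) \<le> exp (- (k * \<kappa>))"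
      by auto
    then show ?thesis unfolding \<zeta>_def snd_conv using k\<sigma> by linarith
  qed
  have b: "M \<le> \<zeta> (x, s)" if s: "0 \<le> s" and x: "Rfun A B x0 t0 + \<delta> \<le> dist x x0" for x s
  proof -
    have "1 * norm (x - x0) \<le> exp (A * s) * q x"
      using A s qn[of x] by (intro mult_mono) auto
    then have "D (x, s) - \<rho> \<ge> \<kappa>"
      using x Rfun_nonneg[OF A B s, of x0] \<delta>
      \<kappa>le by (simp add: D_def \<rho>_def dist_norm)
    then have "exp (k * \<kappa>) \<le> exp (k * (D (x, s) - \<rho>))" using k by simp
    then show ?thesis unfolding \<zeta>_def snd_conv using kM exp_gt_zero[of "k * (s - ts)"] by linarith
  qed
  have c: "M \<le> \<zeta> (x, s)" if s: "t1 \<le> s" for x s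
  proof -
    have "s - ts \<ge> \<kappa>" using s \<kappa>le by (simp add: ts_def field_simps)
    then have "exp (k * \<kappa>) \<le> exp (k * (s - ts))" using k by simp
    then show ?thesis unfolding \<zeta>_def snd_conv using kM exp_gt_zero[of "k * (D (x, s) - \<rho>)"] by linarith
  qed
  have d: "(A * norm x + B) * norm (fst (g (x, s))) + k * exp (- (k * ts)) \<le> snd (g (x, s))"
    if s: "0 \<le> s" for x s
  proof -
    have "norm (fst (g (x, s))) = E (x, s) * (norm (x - x0) / q x)"
      using E[of "(x,s)"] qp[of x] by (simp add: g_def)
    also have "\<dots> \<le> E (x, s)"
      using E[of "(x,s)"] qp[of x] qn[of x] by (simp add: field_simps)
    finally have "(A * norm x + B) * norm (fst (g (x, s))) \<le> (A * norm x + B) * E (x, s)"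
      using A B by (intro mult_left_mono) auto
    also have "\<dots> \<le> (A * q x + (A * norm x0 + B)) * E (x, s)"
    proof -
      have "norm x \<le> norm (x - x0) + norm x0" by norm
      also have "\<dots> \<le> q x + norm x0" using qn[of x] by simp
      finally have "A * norm x \<le> A * (q x + norm x0)" using A by (rule mult_left_mono)
      then show ?thesis using E[of "(x,s)"] by (intro mult_right_mono) (auto simp: algebra_simps)
    qed
    finally have *: "(A * norm x + B) * norm (fst (g (x, s))) \<le> E (x, s) * (A * q x + (A * norm x0 + B))"
      by (simp add: mult.commute)
    have "k * exp (- (k * ts)) \<le> k * exp (k * (s - ts))"
      using k s by (simp add: algebra_simps)
    with * show ?thesis by (simp add: g_def)
  qed
  show ?thesis
    by (rule that[of "k * exp (- (k * ts))" \<zeta> g, OF _ C1 a _ b c d])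
       (use k in \<open>auto simp: \<zeta>_def add_nonneg_nonneg\<close>)
qed

subsection \<open>Comparison\<close>

lemma viscosity_subD:
  assumes "viscosity_sub T H w" "C1_with_grad UNIV \<phi> g" "0 < t" "t < T" "e > 0"
    "\<And>y s. dist (y, s) (x, t) < e \<Longrightarrow> 0 < s \<Longrightarrow> s < T \<Longrightarrow> w y s - \<phi> (y, s) \<le> w x t - \<phi> (x, t)"
  shows "snd (g (x, t)) + H x t (fst (g (x, t))) \<le> 0"
  using assms C1_with_grad_subset[OF assms(2) subset_UNIV]
  unfolding viscosity_sub_def by blast

lemma viscosity_superD:
  assumes "viscosity_super T H w" "C1_with_grad UNIV \<phi> g" "0 < t" "t < T" "e > 0"
    "\<And>y s. dist (y, s) (x, t) < e \<Longrightarrow> 0 < s \<Longrightarrow> s < T \<Longrightarrow> w x t - \<phi> (x, t) \<le> w y s - \<phi> (y, s)"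
  shows "snd (g (x, t)) + H x t (fst (g (x, t))) \<ge> 0"
  using assms C1_with_grad_subset[OF assms(2) subset_UNIV]
  unfolding viscosity_super_def by blast

lemma compact_modulus_of_continuity:
  fixes f :: "'b::metric_space \<Rightarrow> real"
  assumes "continuous_on K f" "compact K" "\<theta> > 0"
  obtains d where "d > 0" "\<And>z z'. z \<in> K \<Longrightarrow> z' \<in> K \<Longrightarrow> dist z z' < d \<Longrightarrow> \<bar>f z - f z'\<bar> < \<theta>"
proof -
  have "uniformly_continuous_on K f" using assms by (intro compact_uniformly_continuous)
  then show ?thesis using that \<open>\<theta> > 0\<close> unfolding uniformly_continuous_on_def dist_real_def by metis
qed

lemma compact_bounded_abs:
  fixes f :: "'b::topological_space \<Rightarrow> real"
  assumes "continuous_on K f" "compact K"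
  obtains M where "M > 0" "\<And>z. z \<in> K \<Longrightarrow> \<bar>f z\<bar> \<le> M"
proof -
  have "bounded (f ` K)" using assms by (simp add: compact_continuous_image compact_imp_bounded)
  then show ?thesis using that by (metis bounded_pos image_eqI real_norm_def)
qed

lemma dist_Pair_le: "dist (x, s) (y, t) \<le> dist x y + dist s t"
  by (simp add: dist_Pair_Pair sqrt_sum_squares_le_sum)

text \<open>With this coefficient a separation of size \<open>d\<close> would cost at least 2 M +
  d^2, more than the 2 M available.\<close>

lemma penalty_small:
  fixes r d a M :: real
  assumes "a * r\<^sup>2 \<le> 2 * M" "M > 0" "d > 0" "a = 2 * M / d\<^sup>2 + 1" "r \<ge> 0"
  shows "r < d"
proof (rule ccontr)
  assume "\<not> r < d"
  then have "d\<^sup>2 \<le> r\<^sup>2" using assms by (intro power_mono) auto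
  then have "a * d\<^sup>2 \<le> a * r\<^sup>2" using assms by (intro mult_left_mono) auto
  moreover have "a * d\<^sup>2 = 2 * M + d\<^sup>2" using assms by (simp add: field_simps)
  ultimately show False using assms by (smt (verit) zero_less_power)
qed

text \<open>Doubling of variables, with the cone barrier \<zeta> subtracted from \<open>w\<close>.
  The barrier confines the maximum to the cone, where the initial ordering is known, and \<zeta>_t -
  (A|x| + B)|\<zeta>_x| \<ge> \<mu> absorbs the Lipschitz dependence on p with \<mu> to spare. The
  remaining errors are kept to 3 \<mu>/4.\<close>

lemma viscosity_comparison:
  fixes w u :: "'a::euclidean_space \<Rightarrow> real \<Rightarrow> real"
  assumes A: "A \<ge> 0" and B: "B \<ge> 0" and C: "C \<ge> 0" and b: "b \<ge> 0"
    and Hcont: "continuous_on (UNIV \<times> {0..T} \<times> UNIV) (\<lambda>(x, t, p). H x t p)"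
    and Hx: "\<And>x y t p. t \<in> {0..T} \<Longrightarrow> \<bar>H x t p - H y t p\<bar> \<le> C * (b + norm p) * dist x y"
    and Hp: "\<And>x t p q. t \<in> {0..T} \<Longrightarrow> \<bar>H x t p - H x t q\<bar> \<le> (A * norm x + B) * dist p q"
    and sub: "viscosity_sub T H w" and super: "viscosity_super T H u"
    and cw: "continuous_on (UNIV \<times> {0..<T}) (\<lambda>(x, t). w x t)"
    and cu: "continuous_on (UNIV \<times> {0..<T}) (\<lambda>(x, t). u x t)"
    and t0: "0 < t0" "t0 < T" and \<delta>: "\<delta> > 0"
    and init: "\<And>x. dist x x0 < Rfun A B x0 t0 + \<delta> \<Longrightarrow> w x 0 \<le> u x 0"
  shows "w x0 t0 \<le> u x0 t0"
proof (rule ccontr)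
  assume "\<not> w x0 t0 \<le> u x0 t0"
  \<comment> \<open>The gap at (x0,t0) is 3 \<sigma>; the barrier takes less than \<sigma> of it, so
    the doubled maximum exceeds 2 \<sigma>.\<close>
  define \<sigma> where "\<sigma> = (w x0 t0 - u x0 t0) / 3"
  have \<sigma>: "\<sigma> > 0" and w0: "w x0 t0 - u x0 t0 = 3 * \<sigma>"
    using \<open>\<not> _\<close> by (auto simp: \<sigma>_def)
  define t1 where "t1 = (t0 + T) / 2"
  define t2 where "t2 = (t1 + T) / 2"
  have ts: "t0 < t1" "t1 < t2" "t2 < T" "0 < t1" "0 < t2" using t0 by (auto simp: t1_def t2_def field_simps)
  define \<rho> where "\<rho> = Rfun A B x0 t0 + \<delta>"
  have \<rho>: "\<rho> > 0" using Rfun_nonneg[OF A B, of t0 x0] t0 \<delta> by (simp add: \<rho>_def)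
  define K where "K = cball x0 (\<rho> + 1) \<times> {0..t2}"
  have K: "compact K" "K \<subseteq> UNIV \<times> {0..<T}"
    using ts by (auto simp: K_def intro: compact_Times)
  have K0: "(x0, t0) \<in> K" using \<rho> t0 ts by (simp add: K_def)
  define W where "W = (\<lambda>(x, t). w x t)"
  define U where "U = (\<lambda>(x, t). u x t)"
  have cW: "continuous_on K W" and cU: "continuous_on K U"
    unfolding W_def U_def using cw cu K(2) continuous_on_subset by blast+
  obtain M1 where M1: "M1 > 0" "\<And>z. z \<in> K \<Longrightarrow> \<bar>W z\<bar> \<le> M1" using compact_bounded_abs[OF cW K(1)] by blast
  obtain M2 where M2: "M2 > 0" "\<And>z. z \<in> K \<Longrightarrow> \<bar>U z\<bar> \<le> M2" using compact_bounded_abs[OF cU K(1)] by blast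
  define M where "M = M1 + M2"
  have M: "M > 0" "\<And>z z'. z \<in> K \<Longrightarrow> z' \<in> K \<Longrightarrow> W z - U z' \<le> 2 * M"
  proof -
    fix z z' assume "z \<in> K" "z' \<in> K"
    then show "W z - U z' \<le> 2 * M" using M1(1) M2(1) M1(2)[of z] M2(2)[of z'] by (simp add: M_def)
  qed (use M1 M2 in \<open>simp add: M_def\<close>)
  obtain \<zeta> g \<mu> where \<mu>: "\<mu> > 0" and C\<zeta>: "C1_with_grad UNIV \<zeta> g" and \<zeta>0: "\<zeta> (x0, t0) < \<sigma>"
    and \<zeta>nn: "\<And>z. \<zeta> z \<ge> 0"
    and \<zeta>1: "\<And>x s. 0 \<le> s \<Longrightarrow> \<rho> \<le> dist x x0 \<Longrightarrow> 2 * M + 1 \<le> \<zeta> (x, s)"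
    and \<zeta>2: "\<And>x s. t1 \<le> s \<Longrightarrow> 2 * M + 1 \<le> \<zeta> (x, s)"
    and \<zeta>3: "\<And>x s. 0 \<le> s \<Longrightarrow> s \<le> t1 \<Longrightarrow> (A * norm x + B) * norm (fst (g (x, s))) + \<mu> \<le> snd (g (x, s))"
    using cone_barrier[OF A B \<delta> \<sigma> ts(1), where ?x0.0 = x0 and M = "2 * M + 1"] unfolding \<rho>_def by metis
  have c\<zeta>: "continuous_on UNIV \<zeta>"
    using C\<zeta> unfolding C1_with_grad_def
    by (meson continuous_at_imp_continuous_on has_derivative_continuous)
  \<comment> \<open>The first bound excludes a maximum at time 0, where the gap could be at most 2
    \<theta> \<le> \<sigma>. The second limits the error 2 C a |x - y|^2 of moving H in x to
    \<mu>/4.\<close>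
  define \<theta> where "\<theta> = min (\<sigma> / 2) (\<mu> / (8 * (C + 1)))"
  have \<theta>: "\<theta> > 0" "\<theta> \<le> \<sigma> / 2" "2 * C * \<theta> \<le> \<mu> / 4"
  proof -
    show "\<theta> > 0" using \<sigma> \<mu> C by (auto simp: \<theta>_def)
    show "\<theta> \<le> \<sigma> / 2" unfolding \<theta>_def by (rule min.cobounded1)
    have "2 * C * \<theta> \<le> 2 * C * (\<mu> / (8 * (C + 1)))" using C by (intro mult_left_mono) (auto simp: \<theta>_def)
    also have "\<dots> = \<mu> / 4 * (C / (C + 1))" using C by (simp add: field_simps)
    also have "\<dots> \<le> \<mu> / 4 * 1" using C \<mu> by (intro mult_left_mono) auto
    finally show "2 * C * \<theta> \<le> \<mu> / 4" by simp
  qed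
  obtain d1 where d1: "d1 > 0" "\<And>z z'. z \<in> K \<Longrightarrow> z' \<in> K \<Longrightarrow> dist z z' < d1 \<Longrightarrow> \<bar>W z - W z'\<bar> < \<theta>"
    using compact_modulus_of_continuity[OF cW K(1) \<theta>(1)] by blast
  obtain d2 where d2: "d2 > 0" "\<And>z z'. z \<in> K \<Longrightarrow> z' \<in> K \<Longrightarrow> dist z z' < d2 \<Longrightarrow> \<bar>U z - U z'\<bar> < \<theta>"
    using compact_modulus_of_continuity[OF cU K(1) \<theta>(1)] by blast
  \<comment> \<open>\<open>d\<close> bounds the separation of the two points: below both moduli of
    continuity after doubling, small enough to keep the second point inside \<open>K\<close>, and
    with C b d \<le> \<mu>/4 for the part of the x-error that does not involve p.\<close>
  define d where "d = min (min d1 d2) (min (min 1 (t2 - t1)) (\<mu> / (4 * (C * b + 1)))) / 2"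
  have d: "d > 0" "2 * d \<le> d1" "2 * d \<le> d2" "d \<le> 1" "d \<le> t2 - t1" "C * b * d \<le> \<mu> / 4"
  proof -
    show p: "d > 0" using d1 d2 ts \<mu> C b by (auto simp: d_def add_nonneg_pos)
    show "2 * d \<le> d1" "2 * d \<le> d2" by (auto simp: d_def)
    have "2 * d \<le> 1" "2 * d \<le> t2 - t1" by (auto simp: d_def)
    with p show "d \<le> 1" "d \<le> t2 - t1" by auto
    have "2 * d \<le> \<mu> / (4 * (C * b + 1))" by (auto simp: d_def)
    then have "d \<le> \<mu> / (4 * (C * b + 1))" using p by linarith
    then have "C * b * d \<le> C * b * (\<mu> / (4 * (C * b + 1)))" using C b by (intro mult_left_mono) auto
    also have "\<dots> = \<mu> / 4 * (C * b / (C * b + 1))" by simp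
    also have "\<dots> \<le> \<mu> / 4 * 1" using C b \<mu> mult_nonneg_nonneg[OF C b] by (intro mult_left_mono) (auto simp: divide_le_eq add_nonneg_pos not_less add_nonneg_nonneg)
    finally show "C * b * d \<le> \<mu> / 4" by simp
  qed
  define a where "a = 2 * M / d\<^sup>2 + 1"
  have a: "a > 0" using M by (simp add: a_def add_nonneg_pos)
  define K3 where "K3 = cball x0 (\<rho> + 1) \<times> {0..t2} \<times> cball (0::'a) (2 * a)"
  have "continuous_on K3 (\<lambda>(x, t, p). H x t p)"
    using Hcont ts by (elim continuous_on_subset) (auto simp: K3_def)
  moreover have "compact K3" by (auto simp: K3_def intro!: compact_Times)
  ultimately obtain dH where dH: "dH > 0" and
    "\<And>z z'. z \<in> K3 \<Longrightarrow> z' \<in> K3 \<Longrightarrow> dist z z' < dH \<Longrightarrow> \<bar>(\<lambda>(x, t, p). H x t p) z - (\<lambda>(x, t, p). H x t p) z'\<bar> < \<mu> / 4"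
    using compact_modulus_of_continuity[of K3 "\<lambda>(x, t, p). H x t p" "\<mu> / 4"] \<mu> by auto
  then have Hmod: "\<bar>H y s p - H y \<tau> p\<bar> < \<mu> / 4"
    if "y \<in> cball x0 (\<rho> + 1)" "s \<in> {0..t2}" "\<tau> \<in> {0..t2}" "norm p \<le> 2 * a" "dist s \<tau> < dH" for y s \<tau> p
  proof -
    have "dist (y, s, p) (y, \<tau>, p) < dH" using that by (simp add: dist_Pair_Pair)
    then show ?thesis
      using that \<open>\<And>z z'. z \<in> K3 \<Longrightarrow> z' \<in> K3 \<Longrightarrow> dist z z' < dH \<Longrightarrow> _\<close>[of "(y, s, p)" "(y, \<tau>, p)"]
      by (auto simp: K3_def)
  qed
  (* H is not uniformly continuous in t as p varies, so the time penalty c is chosen last,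
     when the momenta are already bounded by 2 a. *)
  define d3 where "d3 = min d dH"
  have d3: "d3 > 0" "d3 \<le> d" "d3 \<le> dH" using d dH by (auto simp: d3_def)
  define c where "c = 2 * M / d3\<^sup>2 + 1"
  have c: "c > 0" using M by (simp add: c_def add_nonneg_pos)
  define \<Phi> where "\<Phi> = (\<lambda>(z, z'). W z - U z' - a * (norm (fst z - fst z'))\<^sup>2 - c * (snd z - snd z')\<^sup>2 - \<zeta> z)"
  have "continuous_on (K \<times> K) \<Phi>"
    unfolding \<Phi>_def case_prod_unfold
    by (intro continuous_intros continuous_on_compose2[OF cW] continuous_on_compose2[OF cU]
        continuous_on_compose2[OF c\<zeta>]) auto
  moreover have "compact (K \<times> K)" "K \<times> K \<noteq> {}" using K K0 by (auto intro: compact_Times)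
  ultimately have "\<exists>p\<in>K \<times> K. \<forall>q\<in>K \<times> K. \<Phi> q \<le> \<Phi> p" by (intro continuous_attains_sup)
  then obtain z z' where z: "z \<in> K" "z' \<in> K" and max: "\<And>y y'. y \<in> K \<Longrightarrow> y' \<in> K \<Longrightarrow> \<Phi> (y, y') \<le> \<Phi> (z, z')"
    by (metis SigmaE SigmaI)
  obtain x s where zx: "z = (x, s)" by force
  obtain y \<tau> where zy: "z' = (y, \<tau>)" by force
  have \<Phi>: "\<Phi> ((x1, s1), (y1, \<tau>1)) = w x1 s1 - u y1 \<tau>1 - a * (norm (x1 - y1))\<^sup>2 - c * (s1 - \<tau>1)\<^sup>2 - \<zeta> (x1, s1)"
    for x1 s1 y1 \<tau>1 by (simp add: \<Phi>_def W_def U_def)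
  have xK: "(x, s) \<in> K" and yK: "(y, \<tau>) \<in> K" using z zx zy by auto
  have s0: "s \<ge> 0" "s \<le> t2" and \<tau>0: "\<tau> \<ge> 0" "\<tau> \<le> t2" using xK yK by (auto simp: K_def)
  have low: "\<Phi> (z, z') > 2 * \<sigma>"
    using max[OF K0 K0] \<zeta>0 w0 unfolding \<Phi> by simp
  have nn: "a * (norm (x - y))\<^sup>2 \<ge> 0" "c * (s - \<tau>)\<^sup>2 \<ge> 0" "\<zeta> (x, s) \<ge> 0" using a c \<zeta>nn by auto
  have wu: "w x s - u y \<tau> \<le> 2 * M" using M(2)[OF z] by (simp add: zx zy W_def U_def)
  have "\<zeta> (x, s) < 2 * M + 1" "a * (norm (x - y))\<^sup>2 \<le> 2 * M" "c * \<bar>s - \<tau>\<bar>\<^sup>2 \<le> 2 * M"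
    using low nn wu \<sigma> unfolding zx zy \<Phi> by auto
  then have xy: "norm (x - y) < d" and s\<tau>: "\<bar>s - \<tau>\<bar> < d3" and x\<rho>: "dist x x0 < \<rho>" and st1: "s < t1"
    using penalty_small[of a "norm (x - y)" M d] penalty_small[of c "\<bar>s - \<tau>\<bar>" M d3]
      M d d3 a_def c_def \<zeta>1[of s x] \<zeta>2[of s x] s0 by force+
  have dzz: "dist (x, s) (y, \<tau>) < 2 * d"
    using dist_Pair_le[of x s y \<tau>] xy s\<tau> d3 by (simp add: dist_norm)
  have y\<rho>: "dist y x0 < \<rho> + 1" using dist_triangle[of y x0 x] xy d x\<rho> by (simp add: dist_norm norm_minus_commute)
  have \<tau>t2: "\<tau> < t2" using s\<tau> st1 d3 d by auto
  \<comment> \<open>Comparison with the diagonal pair (x,s), (x,s): \<zeta> depends on the first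
    point only and cancels, so the penalty is bounded by an increment of u. Thus a |x - y|^2 is
    small although a is large.\<close>
  have pen: "a * (norm (x - y))\<^sup>2 + c * (s - \<tau>)\<^sup>2 < \<theta>"
    using max[OF xK xK] d2(2)[OF xK yK] dzz d(3) unfolding zx zy \<Phi> by (simp add: U_def)
  have up: "w x s - u y \<tau> > 2 * \<sigma>" using low nn unfolding zx zy \<Phi> by simp
  have initx: "w x 0 \<le> u x 0" using init x\<rho> by (simp add: \<rho>_def)
  have s_pos: "s > 0"
  proof (rule ccontr)
    assume "\<not> s > 0"
    then have "s = 0" using s0 by simp
    then show False using initx d2(2)[OF xK yK] dzz d(3) up \<theta> \<sigma> by (simp add: U_def)
  qed
  have \<tau>_pos: "\<tau> > 0"
  proof (rule ccontr)
    assume "\<not> \<tau> > 0"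
    then have \<tau>: "\<tau> = 0" using \<tau>0 by simp
    have "(x, 0) \<in> K" using xK by (auto simp: K_def)
    then have "\<bar>w x s - w x 0\<bar> < \<theta>" "\<bar>u x 0 - u y 0\<bar> < \<theta>"
      using d1(2)[OF xK, of "(x, 0)"] d2(2)[of "(x, 0)" "(y, \<tau>)"] yK \<tau> s\<tau> d3 d xy
      by (auto simp: W_def U_def dist_Pair_Pair dist_norm)
    then show False using initx up \<theta> \<sigma> \<tau> by simp
  qed
  define e where "e = min (\<rho> + 1 - dist x x0) (t2 - s)"
  define e' where "e' = min (\<rho> + 1 - dist y x0) (t2 - \<tau>)"
  have e: "e > 0" "e' > 0" using x\<rho> y\<rho> st1 ts \<tau>t2 by (auto simp: e_def e'_def)
  have inK: "(y1, s1) \<in> K" if "dist (y1, s1) (x, s) < e" "0 < s1" for y1 s1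
  proof -
    have "dist y1 x < e" "dist s1 s < e"
      using that(1) dist_fst_le[of "(y1, s1)" "(x, s)"] dist_snd_le[of "(y1, s1)" "(x, s)"] by auto
    then show ?thesis using that(2) dist_triangle[of x0 y1 x]
      by (auto simp: K_def e_def dist_real_def dist_commute)
  qed
  have inK': "(y1, s1) \<in> K" if "dist (y1, s1) (y, \<tau>) < e'" "0 < s1" for y1 s1
  proof -
    have "dist y1 y < e'" "dist s1 \<tau> < e'"
      using that(1) dist_fst_le[of "(y1, s1)" "(y, \<tau>)"] dist_snd_le[of "(y1, s1)" "(y, \<tau>)"] by auto
    then show ?thesis using that(2) dist_triangle[of x0 y1 y]
      by (auto simp: K_def e'_def dist_real_def dist_commute)
  qed
  \<comment> \<open>Both viscosity inequalities carry the same momentum \<open>p\<close> and time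
    slope 2 c (s - \<tau>); only the one for \<open>w\<close> has the gradient of \<zeta> in
    addition.\<close>
  define p where "p = (2 * a) *\<^sub>R (x - y)"
  have I1: "2 * c * (s - \<tau>) + snd (g (x, s)) + H x s (p + fst (g (x, s))) \<le> 0"
  proof -
    note C1_with_grad_add[OF C1_with_grad_quadratic[of UNIV a y c \<tau>] C\<zeta>]
    from viscosity_subD[OF sub this s_pos _ e(1), of x]
    show ?thesis
      using max[OF inK yK] st1 ts unfolding zx zy \<Phi> by (simp add: p_def algebra_simps)
  qed
  have I2: "2 * c * (s - \<tau>) + H y \<tau> p \<ge> 0"
  proof -
    note C1_with_grad_minus[OF C1_with_grad_quadratic[of UNIV a x c s]]
    from viscosity_superD[OF super this \<tau>_pos _ e(2), of y]
    show ?thesis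
      using max[OF xK inK'] \<tau>t2 ts unfolding zx zy \<Phi>
      by (simp add: p_def algebra_simps norm_minus_commute power2_commute)
  qed
  have np: "norm p = 2 * a * norm (x - y)" using a by (simp add: p_def)
  have "norm p \<le> 2 * a" using xy d a np by (simp add: mult_left_le)
  then have "\<bar>H y s p - H y \<tau> p\<bar> < \<mu> / 4"
    using y\<rho> s0 \<tau>0 s\<tau> d3 by (intro Hmod) (auto simp: dist_commute dist_real_def)
  then have h1: "H y s p - H y \<tau> p > - \<mu> / 4" by linarith
  have h2: "H x s p - H y s p \<ge> - (\<mu> / 4 + \<mu> / 4)"
  proof -
    have "C * (b + norm p) * dist x y = C * b * norm (x - y) + 2 * C * (a * (norm (x - y))\<^sup>2)"
      by (simp add: np dist_norm power2_eq_square algebra_simps)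
    also have "C * b * norm (x - y) \<le> C * b * d" using xy C b by (intro mult_left_mono) auto
    also have "a * (norm (x - y))\<^sup>2 \<le> \<theta>" using pen nn by simp
    finally have "C * (b + norm p) * dist x y \<le> C * b * d + 2 * C * \<theta>"
      using C by (simp add: mult_left_mono)
    then show ?thesis using Hx[of s x p y] \<theta>(3) d(6) s0 ts by (simp add: abs_le_iff)
  qed
  have h3: "H x s (p + fst (g (x, s))) - H x s p \<ge> - ((A * norm x + B) * norm (fst (g (x, s))))"
    using Hp[of s x "p + fst (g (x, s))" p] s0 ts by (simp add: dist_norm abs_le_iff)
  show False using I1 I2 h1 h2 h3 \<zeta>3[of s x] s0 st1 \<mu> by simp
qed

subsection \<open>Moving infima and Lipschitz regularity\<close>

text \<open>On the compact set \<open>E\<close> the functions \<open>F z\<close> converge uniformly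
  to \<open>F z0\<close>, and a minimiser for either point is a competitor for the other.\<close>

lemma attained_min_continuous:
  fixes h :: "'b::topological_space \<Rightarrow> real" and F :: "'b \<Rightarrow> 'c::topological_space \<Rightarrow> real"
  assumes cont: "continuous_on (S \<times> E) (\<lambda>(z, e). F z e)" and E: "compact E"
    and att: "\<And>z. z \<in> S \<Longrightarrow> \<exists>e\<in>E. h z = F z e"
    and le: "\<And>z e. z \<in> S \<Longrightarrow> e \<in> E \<Longrightarrow> h z \<le> F z e"
  shows "continuous_on S h"
proof -
  have "(h \<longlongrightarrow> h z0) (at z0 within S)" if z0: "z0 \<in> S" for z0
  proof (rule tendstoI)
    fix \<epsilon> :: real assume \<epsilon>: "\<epsilon> > 0"
    obtain X where X: "z0 \<in> X" "open X"
      and "\<forall>z\<in>X \<inter> S. \<forall>e\<in>E. dist (case (z, e) of (z, e) \<Rightarrow> F z e) (case (z0, e) of (z, e) \<Rightarrow> F z e) \<le> \<epsilon> / 2"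
      by (rule continuous_on_prod_compactE[OF cont E z0, of "\<epsilon> / 2"]) (use \<epsilon> in auto)
    then have FX: "dist (F z e) (F z0 e) \<le> \<epsilon> / 2" if "z \<in> X \<inter> S" "e \<in> E" for z e
      using that by auto
    have "dist (h z) (h z0) < \<epsilon>" if z: "z \<in> X \<inter> S" for z
    proof -
      obtain e where e: "e \<in> E" "h z = F z e" using att z by auto
      obtain e0 where e0: "e0 \<in> E" "h z0 = F z0 e0" using att z0 by auto
      have "h z \<le> F z e0" "h z0 \<le> F z0 e" using le[of z e0] le[of z0 e] z z0 e(1) e0(1) by blast+
      then show ?thesis using e e0 FX[OF z e(1)] FX[OF z e0(1)] \<epsilon>
        unfolding dist_real_def by linarith
    qed
    then show "\<forall>\<^sub>F z in at z0 within S. dist (h z) (h z0) < \<epsilon>"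
      unfolding eventually_at_topological using X by blast
  qed
  then show ?thesis by (simp add: continuous_on_def)
qed

text \<open>The ball of radius r(t) is parametrised by the unit ball, so that the set of competitors
  does not depend on (x,t). Suprema are expressed as the negative of \<open>inf_ball\<close> applied
  to -u.\<close>

definition inf_ball :: "('a::euclidean_space \<Rightarrow> real \<Rightarrow> real) \<Rightarrow> (real \<Rightarrow> real) \<Rightarrow> 'a \<Rightarrow> real \<Rightarrow> real" where
  "inf_ball u r x t = (INF e\<in>cball 0 1. u (x + r t *\<^sub>R e) t)"

lemma inf_ball_attained:
  assumes cu: "continuous_on (UNIV \<times> {0..<T}) (\<lambda>(x, t). u x t)" and t: "0 \<le> t" "t < T"
  obtains e where "norm e \<le> 1" "inf_ball u r x t = u (x + r t *\<^sub>R e) t"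
    "\<And>e. norm e \<le> 1 \<Longrightarrow> inf_ball u r x t \<le> u (x + r t *\<^sub>R e) t"
proof -
  have "continuous_on (cball 0 1) (\<lambda>e. u (x + r t *\<^sub>R e) t)"
    using t by (auto intro!: continuous_intros
        continuous_on_compose2[OF cu, of _ "\<lambda>e. (x + r t *\<^sub>R e, t)", simplified])
  then obtain e where e: "e \<in> cball 0 1" "\<And>e'. e' \<in> cball 0 1 \<Longrightarrow> u (x + r t *\<^sub>R e) t \<le> u (x + r t *\<^sub>R e') t"
    using continuous_attains_inf[of "cball 0 1" "\<lambda>e. u (x + r t *\<^sub>R e) t"] by auto
  then have *: "inf_ball u r x t = u (x + r t *\<^sub>R e) t"
    unfolding inf_ball_def by (intro cInf_eq_minimum) auto
  show ?thesis using that[of e] e * by auto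
qed

lemma inf_ball_le:
  assumes "continuous_on (UNIV \<times> {0..<T}) (\<lambda>(x, t). u x t)" "0 \<le> t" "t < T" "norm e \<le> 1"
  shows "inf_ball u r x t \<le> u (x + r t *\<^sub>R e) t"
  using inf_ball_attained[OF assms(1-3)] assms(4) by metis

lemma continuous_on_inf_ball:
  assumes cu: "continuous_on (UNIV \<times> {0..<T}) (\<lambda>(x, t). u x t)" and r: "continuous_on {0..<T} r"
  shows "continuous_on (UNIV \<times> {0..<T}) (\<lambda>(x, t). inf_ball u r x t)"
proof (rule attained_min_continuous[where F = "\<lambda>z e. u (fst z + r (snd z) *\<^sub>R e) (snd z)" and E = "cball 0 1"])
  have rs: "continuous_on ((UNIV \<times> {0..<T}) \<times> cball 0 1) (\<lambda>z::('a \<times> real) \<times> 'a. r (snd (fst z)))"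
    by (rule continuous_on_compose2[OF r]) (auto intro!: continuous_intros)
  show "continuous_on ((UNIV \<times> {0..<T}) \<times> cball 0 1) (\<lambda>(z, e). u (fst z + r (snd z) *\<^sub>R e) (snd z))"
    unfolding case_prod_unfold
    by (rule continuous_on_compose2[OF cu, of _ "\<lambda>z. (fst (fst z) + r (snd (fst z)) *\<^sub>R snd z, snd (fst z))", simplified])
       (auto intro!: continuous_intros rs)
  fix z :: "'a \<times> real" assume "z \<in> UNIV \<times> {0..<T}"
  then have z: "0 \<le> snd z" "snd z < T" by auto
  show "\<exists>e\<in>cball 0 1. (case z of (x, t) \<Rightarrow> inf_ball u r x t) = u (fst z + r (snd z) *\<^sub>R e) (snd z)"
    by (rule inf_ball_attained[OF cu z, of r "fst z"]) (auto simp: case_prod_unfold)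
  fix e :: 'a assume "e \<in> cball 0 1"
  then show "(case z of (x, t) \<Rightarrow> inf_ball u r x t) \<le> u (fst z + r (snd z) *\<^sub>R e) (snd z)"
    using inf_ball_le[OF cu z, of e r "fst z"] by (simp add: case_prod_unfold)
qed simp

section \<open>Test functions on moving balls and the Lipschitz estimate\<close>

lemma C1_with_grad_directional:
  assumes "C1_with_grad S \<phi> g" "(x, t) \<in> S"
  shows "((\<lambda>h. \<phi> (x + h *\<^sub>R d, t + h * k)) has_real_derivative g (x, t) \<bullet> (d, k)) (at 0)"
proof -
  have "(\<phi> has_derivative (\<lambda>h. g (x, t) \<bullet> h)) (at (x + 0 *\<^sub>R d, t + 0 * k))"
    using assms by (simp add: C1_with_grad_def)
  moreover have "((\<lambda>h. (x + h *\<^sub>R d, t + h * k)) has_derivative (\<lambda>h. h *\<^sub>R (d, k))) (at 0)"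
    by (auto intro!: derivative_eq_intros)
  ultimately have "((\<lambda>h. \<phi> (x + h *\<^sub>R d, t + h * k)) has_derivative (\<lambda>h. g (x, t) \<bullet> (h *\<^sub>R (d, k)))) (at 0)"
    by (rule has_derivative_compose[rotated])
  then show ?thesis
    unfolding has_field_derivative_def
    by (rule has_derivative_eq_rhs) (simp add: fun_eq_iff inner_scaleR_right del: scaleR_Pair)
qed

text \<open>If the offset \<open>e\<close> is kept fixed, a test function at x becomes one at y = x
  + r(t) e. The motion of the ball contributes -r'(t) (e . p) to the time derivative.\<close>

lemma C1_with_grad_moving_shift:
  fixes e :: "'a::euclidean_space"
  assumes \<phi>: "C1_with_grad (UNIV \<times> I) \<phi> g"
    and r: "\<And>s. (r has_real_derivative r' s) (at s)" "continuous_on UNIV r'"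
    and c: "\<And>s. (c has_real_derivative c' s) (at s)" "continuous_on UNIV c'"
  shows "C1_with_grad (UNIV \<times> I) (\<lambda>z. \<phi> (fst z - r (snd z) *\<^sub>R e, snd z) + c (snd z))
      (\<lambda>z. (fst (g (fst z - r (snd z) *\<^sub>R e, snd z)),
            snd (g (fst z - r (snd z) *\<^sub>R e, snd z))
              - r' (snd z) * (e \<bullet> fst (g (fst z - r (snd z) *\<^sub>R e, snd z))) + c' (snd z)))"
proof -
  define \<Sigma> where "\<Sigma> z = (fst z - r (snd z) *\<^sub>R e, snd z)" for z :: "'a \<times> real"
  have rd: "((\<lambda>z. r (snd z)) has_derivative (\<lambda>h. r' (snd z) * snd h)) (at z)" for z :: "'a \<times> real"
    by (rule has_derivative_compose[where g=r and f=snd])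
       (use r in \<open>auto intro!: derivative_eq_intros simp: has_field_derivative_def\<close>)
  have cd: "((\<lambda>z. c (snd z)) has_derivative (\<lambda>h. c' (snd z) * snd h)) (at z)" for z :: "'a \<times> real"
    by (rule has_derivative_compose[where g=c and f=snd])
       (use c in \<open>auto intro!: derivative_eq_intros simp: has_field_derivative_def\<close>)
  have \<Sigma>d: "(\<Sigma> has_derivative (\<lambda>h. (fst h - (r' (snd z) * snd h) *\<^sub>R e, snd h))) (at z)" for z
    unfolding \<Sigma>_def[abs_def] by (rule derivative_eq_intros rd refl | simp)+
  have c\<Sigma>: "continuous_on UNIV \<Sigma>"
    using \<Sigma>d by (meson UNIV_I continuous_at_imp_continuous_on has_derivative_continuous)
  have "((\<lambda>z. \<phi> (\<Sigma> z) + c (snd z)) has_derivative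
       (\<lambda>h. (fst (g (\<Sigma> z)), snd (g (\<Sigma> z)) - r' (snd z) * (e \<bullet> fst (g (\<Sigma> z))) + c' (snd z)) \<bullet> h)) (at z)"
    if "z \<in> UNIV \<times> I" for z
  proof -
    have "\<Sigma> z \<in> UNIV \<times> I" using that by (auto simp: \<Sigma>_def)
    then have "(\<phi> has_derivative (\<lambda>h. g (\<Sigma> z) \<bullet> h)) (at (\<Sigma> z))"
      using \<phi> by (auto simp: C1_with_grad_def)
    from has_derivative_add[OF has_derivative_compose[OF \<Sigma>d this] cd]
    show ?thesis
      by (rule has_derivative_eq_rhs)
         (auto simp: inner_prod_def inner_diff_right algebra_simps inner_commute)
  qed
  moreover have "continuous_on (UNIV \<times> I)
     (\<lambda>z. (fst (g (\<Sigma> z)), snd (g (\<Sigma> z)) - r' (snd z) * (e \<bullet> fst (g (\<Sigma> z))) + c' (snd z)))"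
  proof -
    have 1: "continuous_on (UNIV \<times> I) (\<lambda>z. g (\<Sigma> z))"
      by (rule continuous_on_compose2[of "UNIV \<times> I" g])
         (use \<phi> c\<Sigma> in \<open>auto simp: C1_with_grad_def \<Sigma>_def intro: continuous_on_subset\<close>)
    have 2: "continuous_on (UNIV \<times> I) (\<lambda>z::'a\<times>real. r' (snd z))" "continuous_on (UNIV \<times> I) (\<lambda>z::'a\<times>real. c' (snd z))"
      by (auto intro!: continuous_on_compose2[OF r(2)] continuous_on_compose2[OF c(2)] continuous_intros)
    show ?thesis by (intro continuous_intros 1 2)
  qed
  ultimately show ?thesis unfolding C1_with_grad_def \<Sigma>_def by blast
qed

text \<open>First-order condition on a ball, written as equality in Cauchy-Schwarz: p vanishes if
  the offset is interior and is a nonnegative multiple of e if |e| = 1. A direction d moves the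
  centre while the point at offset r e stays fixed, hence the new offset r e - h d.\<close>

lemma norm_le_inner_of_inward_directions:
  fixes e p :: "'a::euclidean_space"
  assumes r: "r > 0" and e: "norm e \<le> 1"
    and d: "\<And>d h0. h0 > 0 \<Longrightarrow> (\<And>h. 0 < h \<Longrightarrow> h < h0 \<Longrightarrow> norm (r *\<^sub>R e - h *\<^sub>R d) \<le> r) \<Longrightarrow> 0 \<le> p \<bullet> d"
  shows "norm p \<le> e \<bullet> p"
proof (cases "norm e < 1")
  case True
  have "0 \<le> p \<bullet> (- p)"
  proof (rule d[of "r * (1 - norm e) / (norm p + 1)"])
    show "0 < r * (1 - norm e) / (norm p + 1)" using r True by (simp add: add_nonneg_pos)
    fix h assume h: "0 < h" "h < r * (1 - norm e) / (norm p + 1)"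
    have "norm (r *\<^sub>R e - h *\<^sub>R (- p)) \<le> r * norm e + h * norm p"
      using norm_triangle_ineq[of "r *\<^sub>R e" "h *\<^sub>R p"] r h by simp
    also have "h * norm p \<le> h * (norm p + 1)" using h by simp
    also have "\<dots> \<le> r * (1 - norm e)" using h by (simp add: pos_less_divide_eq add_nonneg_pos)
    finally show "norm (r *\<^sub>R e - h *\<^sub>R (- p)) \<le> r" by (simp add: algebra_simps)
  qed
  then have "p = 0" by (metis inner_minus_right inner_ge_zero inner_eq_zero_iff neg_0_le_iff_le order_antisym)
  then show ?thesis by simp
next
  case False
  then have e1: "norm e = 1" using e by simp
  show ?thesis
  proof (rule ccontr)
    assume less: "\<not> norm p \<le> e \<bullet> p"
    define \<eta> where "\<eta> = norm p - e \<bullet> p"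
    have \<eta>: "\<eta> > 0" using less by (simp add: \<eta>_def)
    \<comment> \<open>The descent direction -p is tilted towards e until it points strictly inwards:
      v . e = 2 \<eta>, while p . v = -\<eta>^2 is still negative.\<close>
    define v where "v = - p + (norm p + \<eta>) *\<^sub>R e"
    have ee: "e \<bullet> e = 1" using e1 by (simp add: norm_eq_1)
    have ve: "v \<bullet> e = 2 * \<eta>"
      unfolding v_def inner_add_left inner_minus_left inner_scaleR_left ee inner_commute[of p e]
      by (simp add: \<eta>_def)
    have "0 \<le> p \<bullet> v"
    proof (rule d[of "r * \<eta> / (v \<bullet> v + 1)"])
      show "0 < r * \<eta> / (v \<bullet> v + 1)" using r \<eta> by (simp add: add_nonneg_pos)
      fix h assume h: "0 < h" "h < r * \<eta> / (v \<bullet> v + 1)"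
      have "h * (v \<bullet> v) \<le> h * (v \<bullet> v + 1)" using h by simp
      also have "\<dots> \<le> r * \<eta>" using h by (simp add: pos_less_divide_eq add_nonneg_pos)
      finally have "h * (h * (v \<bullet> v)) \<le> h * (r * \<eta>)" using h by simp
      moreover have "h * (r * \<eta>) \<ge> 0" using h r \<eta> by simp
      moreover have "(norm (r *\<^sub>R e - h *\<^sub>R v))\<^sup>2 = r\<^sup>2 - 4 * (h * (r * \<eta>)) + h * (h * (v \<bullet> v))"
        using ve unfolding power2_norm_eq_inner
        by (simp add: inner_diff_left inner_diff_right inner_commute[of e v] ee power2_eq_square algebra_simps)
      ultimately have "(norm (r *\<^sub>R e - h *\<^sub>R v))\<^sup>2 \<le> r\<^sup>2" by linarith
      then show "norm (r *\<^sub>R e - h *\<^sub>R v) \<le> r" using r by (simp add: power2_le_iff_abs_le)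
    qed
    also have "p \<bullet> v = - (norm p)\<^sup>2 + (norm p + \<eta>) * (e \<bullet> p)"
      unfolding v_def inner_add_right inner_minus_right inner_scaleR_right power2_norm_eq_inner inner_commute[of p e]
      by simp
    also have "\<dots> = - \<eta>\<^sup>2" by (simp add: \<eta>_def power2_eq_square algebra_simps)
    finally show False using \<eta> by simp
  qed
qed

text \<open>At a maximiser y = x + r e the shifted test function touches u from above, and
  optimality of x gives |p| \<le> e . p. Shrinking at rate C then contributes C r (e . p) \<ge> C r
  |p|, which pays for moving H from y to x up to C b r \<le> C b r0; the slope in time of the
  subtracted term pays for the latter. Its value r0 L at time 0 is there for the initial
  comparison.\<close>

lemma sup_ball_subsolution:
  fixes u :: "'a::euclidean_space \<Rightarrow> real \<Rightarrow> real"
  assumes C: "C \<ge> 0" and b: "b \<ge> 0" and r0: "r0 > 0"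
    and Hx: "\<And>x y t p. t \<in> {0..T} \<Longrightarrow> \<bar>H x t p - H y t p\<bar> \<le> C * (b + norm p) * dist x y"
    and sub: "viscosity_sub T H u"
    and cu: "continuous_on (UNIV \<times> {0..<T}) (\<lambda>(x, t). u x t)"
  shows "viscosity_sub T H (\<lambda>x t. - inf_ball (\<lambda>x t. - u x t) (\<lambda>t. r0 * exp (- C * t)) x t - r0 * (L + C * b * t))"
    (is "viscosity_sub T H ?w")
  unfolding viscosity_sub_def
proof (intro allI impI)
  fix \<phi> :: "'a \<times> real \<Rightarrow> real" and g x t
  assume \<phi>: "C1_with_grad (UNIV \<times> {0<..<T}) \<phi> g" and t: "0 < t" "t < T"
  assume "\<exists>e>0. \<forall>y s. dist (y, s) (x, t) < e \<and> 0 < s \<and> s < T \<longrightarrow> ?w y s - \<phi> (y, s) \<le> ?w x t - \<phi> (x, t)"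
  then obtain e1 where e1: "e1 > 0"
    and max: "\<And>y s. dist (y, s) (x, t) < e1 \<Longrightarrow> 0 < s \<Longrightarrow> s < T \<Longrightarrow> ?w y s - \<phi> (y, s) \<le> ?w x t - \<phi> (x, t)"
    by blast
  define r where "r = (\<lambda>t. r0 * exp (- C * t))"
  define c where "c = (\<lambda>t. r0 * (L + C * b * t))"
  define W where "W = (\<lambda>x t. - inf_ball (\<lambda>x t. - u x t) r x t - c t)"
  have max: "W y s - \<phi> (y, s) \<le> W x t - \<phi> (x, t)" if "dist (y, s) (x, t) < e1" "0 < s" "s < T" for y s
    using max[OF that] by (simp add: W_def r_def c_def)
  have cu': "continuous_on (UNIV \<times> {0..<T}) (\<lambda>(x, t). - u x t)"
    using continuous_on_minus[OF cu] by (simp add: case_prod_unfold)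
  have Wge: "u (y + r s *\<^sub>R e) s - c s \<le> W y s" if "norm e \<le> 1" "0 < s" "s < T" for y e s
    using inf_ball_le[OF cu', of s e r y] that by (simp add: W_def)
  obtain e where e: "norm e \<le> 1" and We: "W x t = u (x + r t *\<^sub>R e) t - c t"
    by (rule inf_ball_attained[OF cu', of t r x]) (use t in \<open>auto simp: W_def\<close>)
  define p where "p = fst (g (x, t))"
  define y where "y = x + r t *\<^sub>R e"
  have rpos: "r s > 0" for s using r0 by (simp add: r_def)
  have rd: "(r has_real_derivative - C * r s) (at s)" for s
    unfolding r_def by (auto intro!: derivative_eq_intros)
  have cd: "(c has_real_derivative r0 * C * b) (at s)" for s
    unfolding c_def by (auto intro!: derivative_eq_intros)
  have rc: "isCont r t" using rd DERIV_isCont by blast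
  have cr': "continuous_on UNIV (\<lambda>s. - C * r s)" unfolding r_def by (intro continuous_intros)
  note C1 = C1_with_grad_moving_shift[OF \<phi> rd cr' cd continuous_on_const, of e]
  obtain d where d: "d > 0" "\<And>s. dist s t < d \<Longrightarrow> dist (r s) (r t) < e1 / 4"
    using rc[unfolded continuous_at_eps_delta, rule_format, of "e1 / 4"] e1 by (auto simp: dist_real_def)
  have "\<exists>e>0. \<forall>y' s. dist (y', s) (y, t) < e \<and> 0 < s \<and> s < T \<longrightarrow>
        u y' s - (\<phi> (y' - r s *\<^sub>R e0, s) + c s) \<le> u y t - (\<phi> (y - r t *\<^sub>R e0, t) + c t)" if "e0 = e" for e0
  proof (intro exI conjI allI impI)
    show "min d (e1 / 4) > 0" using d e1 by simp
    fix y' s assume as: "dist (y', s) (y, t) < min d (e1 / 4) \<and> 0 < s \<and> s < T"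
    have 1: "dist y' y < e1 / 4" "dist s t < e1 / 4" "dist s t < d"
      using as dist_fst_le[of "(y', s)" "(y, t)"] dist_snd_le[of "(y', s)" "(y, t)"] by auto
    have "dist (y' - r s *\<^sub>R e) x = norm ((y' - y) - (r s - r t) *\<^sub>R e)"
      by (simp add: y_def dist_norm algebra_simps)
    also have "\<dots> \<le> norm (y' - y) + norm ((r s - r t) *\<^sub>R e)" by (rule norm_triangle_ineq4)
    also have "norm ((r s - r t) *\<^sub>R e) \<le> \<bar>r s - r t\<bar>" using e by (simp add: mult_left_le)
    finally have "dist (y' - r s *\<^sub>R e) x < e1 / 2"
      using 1 d(2)[of s] by (simp add: dist_norm)
    then have "dist (y' - r s *\<^sub>R e, s) (x, t) < e1"
      using dist_Pair_le[of "y' - r s *\<^sub>R e" s x t] 1 e1 by linarith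
    then have "W (y' - r s *\<^sub>R e) s - \<phi> (y' - r s *\<^sub>R e, s) \<le> W x t - \<phi> (x, t)"
      using max as by blast
    moreover have "u y' s - c s \<le> W (y' - r s *\<^sub>R e) s"
      using Wge[of e s "y' - r s *\<^sub>R e"] e as by simp
    ultimately show "u y' s - (\<phi> (y' - r s *\<^sub>R e0, s) + c s) \<le> u y t - (\<phi> (y - r t *\<^sub>R e0, t) + c t)"
      using We that by (simp add: y_def)
  qed
  then have ineq: "snd (g (x, t)) + C * r t * (e \<bullet> p) + r0 * C * b + H y t p \<le> 0"
    using sub[unfolded viscosity_sub_def, rule_format, OF C1 t, of y]
    by (simp add: y_def p_def)
  (* phi(., t) is minimal at x on the ball of radius r(t) around the maximiser y *)
  have "norm p \<le> e \<bullet> p"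
  proof (rule norm_le_inner_of_inward_directions[OF rpos[of t] e])
    fix d and h0 :: real
    assume h0: "h0 > 0" and inw: "\<And>h. 0 < h \<Longrightarrow> h < h0 \<Longrightarrow> norm (r t *\<^sub>R e - h *\<^sub>R d) \<le> r t"
    show "0 \<le> p \<bullet> d"
    proof (rule ccontr)
      assume "\<not> 0 \<le> p \<bullet> d"
      moreover have "((\<lambda>h. \<phi> (x + h *\<^sub>R d, t + h * 0)) has_real_derivative p \<bullet> d) (at 0)"
        using C1_with_grad_directional[OF \<phi>, of x t d 0] t by (simp add: p_def inner_prod_def)
      ultimately obtain h1 where h1: "h1 > 0" "\<And>h. 0 < h \<Longrightarrow> h < h1 \<Longrightarrow> \<phi> (x + h *\<^sub>R d, t) < \<phi> (x, t)"
        using DERIV_neg_dec_right[of "\<lambda>h. \<phi> (x + h *\<^sub>R d, t + h * 0)" "p \<bullet> d" 0] by auto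
      define k where "k = e1 / (norm d + 1)"
      have k: "k > 0" using e1 by (simp add: k_def add_nonneg_pos)
      define h where "h = min (min h0 h1) k / 2"
      have h: "0 < h" "h < h0" "h < h1" "h < e1 / (norm d + 1)"
        unfolding k_def[symmetric] using h0 h1(1) k by (auto simp: h_def min_def)
      have "h * norm d < e1"
      proof -
        have "h * (norm d + 1) < e1" using h(4) by (simp add: pos_less_divide_eq add_nonneg_pos)
        then show ?thesis using h(1) by (simp add: algebra_simps)
      qed
      then have "dist (x + h *\<^sub>R d, t) (x, t) < e1"
        using h by (simp add: dist_Pair_Pair dist_norm)
      then have 1: "W (x + h *\<^sub>R d) t - \<phi> (x + h *\<^sub>R d, t) \<le> W x t - \<phi> (x, t)" using max t by blast
      \<comment> \<open>The offset at which the same maximiser y is seen from the displaced centre x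
        + h d.\<close>
      define e' where "e' = (1 / r t) *\<^sub>R (r t *\<^sub>R e - h *\<^sub>R d)"
      have "norm e' \<le> 1" using inw[OF h(1,2)] rpos[of t] by (simp add: e'_def)
      from Wge[OF this t, of "x + h *\<^sub>R d"] have "u y t - c t \<le> W (x + h *\<^sub>R d) t"
        using rpos[of t] by (simp add: e'_def y_def)
      then show False using 1 We h1(2)[OF h(1,3)] by (simp add: y_def)
    qed
  qed
  then have "C * r t * norm p \<le> C * r t * (e \<bullet> p)" using C rpos[of t] by (intro mult_left_mono) auto
  moreover have "H x t p - H y t p \<le> C * b * r0 + C * r t * norm p"
  proof -
    have "C * (b + norm p) * dist x y \<le> C * (b + norm p) * r t"
      using C b e rpos[of t] by (intro mult_left_mono) (auto simp: y_def dist_norm mult_left_le)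
    moreover have "C * b * r t \<le> C * b * r0"
      using C b r0 t by (intro mult_left_mono) (auto simp: r_def mult_left_le)
    ultimately show ?thesis using Hx[of t x p y] t by (simp add: algebra_simps abs_le_iff)
  qed
  ultimately show "snd (g (x, t)) + H x t (fst (g (x, t))) \<le> 0"
    using ineq by (simp add: p_def algebra_simps)
qed

text \<open>Comparison of u with its own supremum over shrinking balls: initially the subtracted r0
  L dominates the oscillation of u(.,0) on a ball of radius r0, and at time t the supremum still
  sees y from x.\<close>

lemma solution_lipschitz:
  fixes u :: "'a::euclidean_space \<Rightarrow> real \<Rightarrow> real"
  assumes A: "A \<ge> 0" and B: "B \<ge> 0" and C: "C \<ge> 0" and b: "b \<ge> 0"
    and Hcont: "continuous_on (UNIV \<times> {0..T} \<times> UNIV) (\<lambda>(x, t, p). H x t p)"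
    and Hx: "\<And>x y t p. t \<in> {0..T} \<Longrightarrow> \<bar>H x t p - H y t p\<bar> \<le> C * (b + norm p) * dist x y"
    and Hp: "\<And>x t p q. t \<in> {0..T} \<Longrightarrow> \<bar>H x t p - H x t q\<bar> \<le> (A * norm x + B) * dist p q"
    and sub: "viscosity_sub T H u" and super: "viscosity_super T H u"
    and cu: "continuous_on (UNIV \<times> {0..<T}) (\<lambda>(x, t). u x t)"
    and L: "L \<ge> 0" "\<And>x y. \<bar>u x 0 - u y 0\<bar> \<le> L * dist x y"
  obtains \<Lambda> where "\<Lambda> > 0" "\<And>x y t. 0 < t \<Longrightarrow> t < T \<Longrightarrow> \<bar>u x t - u y t\<bar> \<le> \<Lambda> * dist x y"
proof -
  define \<Lambda> where "\<Lambda> = exp (C * T) * (L + C * b * \<bar>T\<bar>) + 1"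
  have one: "u y t - u x t \<le> \<Lambda> * dist x y" if t: "0 < t" "t < T" for x y t
  proof (cases "x = y")
    case False
    \<comment> \<open>The initial radius for which the ball has shrunk to radius |x - y| exactly at
      time t.\<close>
    define r0 where "r0 = dist x y * exp (C * t)"
    have r0: "r0 > 0" using False by (simp add: r0_def)
    define r where "r = (\<lambda>t. r0 * exp (- C * t))"
    define W where "W = (\<lambda>x t. - inf_ball (\<lambda>x t. - u x t) r x t - r0 * (L + C * b * t))"
    have cu': "continuous_on (UNIV \<times> {0..<T}) (\<lambda>(x, t). - u x t)"
      using continuous_on_minus[OF cu] by (simp add: case_prod_unfold)
    have "continuous_on (UNIV \<times> {0..<T}) (\<lambda>(x, t). inf_ball (\<lambda>x t. - u x t) r x t)"
      by (rule continuous_on_inf_ball[OF cu']) (auto simp: r_def intro!: continuous_intros)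
    then have cW: "continuous_on (UNIV \<times> {0..<T}) (\<lambda>(x, t). W x t)"
      unfolding W_def case_prod_unfold by (intro continuous_intros)
    have "viscosity_sub T H W"
      using sup_ball_subsolution[OF C b r0 Hx sub cu] by (simp add: W_def r_def)
    moreover have "W z 0 \<le> u z 0" for z
    proof -
      obtain e where e: "norm e \<le> 1" "inf_ball (\<lambda>x t. - u x t) r z 0 = - u (z + r 0 *\<^sub>R e) 0"
        by (rule inf_ball_attained[OF cu', of 0 r z]) (use t in auto)
      have "u (z + r 0 *\<^sub>R e) 0 - u z 0 \<le> L * dist (z + r 0 *\<^sub>R e) z" using L(2) by (simp add: abs_le_iff)
      also have "\<dots> \<le> L * r0" using e r0 L(1) by (intro mult_left_mono) (auto simp: r_def dist_norm mult_left_le)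
      finally show ?thesis using e by (simp add: W_def mult.commute)
    qed
    ultimately have "W x t \<le> u x t"
      by (intro viscosity_comparison[OF A B C b Hcont Hx Hp _ super cW cu t, of 1]) auto
    moreover have "u y t - r0 * (L + C * b * t) \<le> W x t"
    proof -
      have rt: "r t = dist x y" by (simp add: r_def r0_def exp_minus)
      have "inf_ball (\<lambda>x t. - u x t) r x t \<le> - u (x + r t *\<^sub>R ((1 / dist x y) *\<^sub>R (y - x))) t"
        by (rule inf_ball_le[OF cu']) (use t False in \<open>auto simp: dist_norm norm_minus_commute\<close>)
      then show ?thesis using False by (simp add: rt W_def)
    qed
    ultimately have "u y t - u x t \<le> r0 * (L + C * b * t)" by simp
    also have "\<dots> = dist x y * (exp (C * t) * (L + C * b * t))" by (simp add: r0_def)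
    also have "\<dots> \<le> dist x y * (exp (C * T) * (L + C * b * \<bar>T\<bar>))"
      using C b L t by (intro mult_left_mono mult_mono add_mono) (auto simp: mult_left_mono)
    also have "\<dots> \<le> dist x y * \<Lambda>" by (intro mult_left_mono) (auto simp: \<Lambda>_def)
    finally show ?thesis by (simp add: mult.commute)
  qed simp
  show ?thesis
  proof (rule that[of \<Lambda>])
    show "\<Lambda> > 0" using C b L by (simp add: \<Lambda>_def add_nonneg_pos)
    show "\<bar>u x t - u y t\<bar> \<le> \<Lambda> * dist x y" if "0 < t" "t < T" for x y t
      using one[OF that, of x y] one[OF that, of y x] by (simp add: dist_commute abs_le_iff)
  qed
qed

subsection \<open>Affine minorants of the Hamiltonian\<close>

text \<open>A hyperplane separates the hypograph of \<open>K\<close> from the strict epigraph of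
  \<open>G\<close>; strictness keeps the two sets disjoint where the functions meet. The hyperplane
  is not vertical because both functions are finite everywhere, so it is the graph of an affine
  function.\<close>

lemma affine_sandwich:
  fixes G K :: "'a::euclidean_space \<Rightarrow> real"
  assumes G: "convex_on UNIV G" and K: "concave_on UNIV K" and KG: "\<And>q. K q \<le> G q"
  obtains a v where "\<And>q. K q \<le> a + v \<bullet> q" "\<And>q. a + v \<bullet> q \<le> G q"
proof -
  define S where "S = {z. snd z \<le> K (fst z)}"
  define E where "E = {z. G (fst z) < snd z}"
  have "convex S"
  proof (rule convexI)
    fix y z and s t :: real
    assume as: "y \<in> S" "z \<in> S" "0 \<le> s" "0 \<le> t" "s + t = 1"
    have "s * snd y + t * snd z \<le> s * K (fst y) + t * K (fst z)"
      using as by (intro add_mono mult_left_mono) (auto simp: S_def)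
    also have "\<dots> \<le> K (s *\<^sub>R fst y + t *\<^sub>R fst z)"
      using K as by (auto simp: concave_on_iff)
    finally show "s *\<^sub>R y + t *\<^sub>R z \<in> S" by (simp add: S_def)
  qed
  moreover have "convex E"
  proof (rule convexI)
    fix y z and s t :: real
    assume as: "y \<in> E" "z \<in> E" "0 \<le> s" "0 \<le> t" "s + t = 1"
    have "G (s *\<^sub>R fst y + t *\<^sub>R fst z) \<le> s * G (fst y) + t * G (fst z)"
      using G as by (auto simp: convex_on_def)
    also have "\<dots> < s * snd y + t * snd z"
    proof (cases "s = 0")
      case False
      then show ?thesis using as
        by (intro add_less_le_mono mult_strict_left_mono mult_left_mono) (auto simp: E_def)
    qed (use as in \<open>auto simp: E_def\<close>)
    finally show "s *\<^sub>R y + t *\<^sub>R z \<in> E" by (simp add: E_def)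
  qed
  moreover have "(0, K 0) \<in> S" "(0, G 0 + 1) \<in> E" by (auto simp: S_def E_def)
  moreover have "z \<notin> E" if "z \<in> S" for z using KG[of "fst z"] that by (simp add: S_def E_def)
  then have "S \<inter> E = {}" by blast
  ultimately obtain nm \<beta> where nm: "nm \<noteq> 0" "\<And>z. z \<in> S \<Longrightarrow> nm \<bullet> z \<le> \<beta>" "\<And>z. z \<in> E \<Longrightarrow> \<beta> \<le> nm \<bullet> z"
    using separating_hyperplane_sets[of S E] by blast
  obtain n m where nmeq: "nm = (n, m)" by force
  have S: "n \<bullet> q + m * y \<le> \<beta>" if "y \<le> K q" for q y
    using nm(2)[of "(q, y)"] that by (simp add: S_def nmeq)
  have E: "\<beta> \<le> n \<bullet> q + m * y" if "G q < y" for q y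
    using nm(3)[of "(q, y)"] that by (simp add: E_def nmeq)
  have "m \<noteq> 0"
  proof
    assume m: "m = 0"
    have nb: "n \<bullet> q = \<beta>" for q using S[of "K q" q] E[of q "G q + 1"] m by simp
    have "n \<bullet> n = 0" using nb[of n] nb[of 0] by simp
    then show False using nm(1) m nmeq by (simp add: zero_prod_def)
  qed
  moreover have "m \<ge> 0"
  proof -
    have "m * K 0 \<le> \<beta>" "\<beta> \<le> m * (G 0 + 1)" using S[of "K 0" 0] E[of 0 "G 0 + 1"] by auto
    then have "0 \<le> m * (G 0 + 1 - K 0)" by (simp add: algebra_simps)
    then show ?thesis using KG[of 0] by (simp add: zero_le_mult_iff)
  qed
  ultimately have m: "m > 0" by simp
  show ?thesis
  proof (rule that[of "\<beta> / m" "(- 1 / m) *\<^sub>R n"])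
    fix q
    show "K q \<le> \<beta> / m + ((- 1 / m) *\<^sub>R n) \<bullet> q"
      using S[of "K q" q] m by (simp add: field_simps)
    have "(\<beta> - n \<bullet> q) / m \<le> G q"
    proof (rule field_le_epsilon)
      fix e :: real assume "e > 0"
      then have "\<beta> \<le> n \<bullet> q + m * (G q + e)" using E by simp
      then show "(\<beta> - n \<bullet> q) / m \<le> G q + e" using m by (simp add: field_simps)
    qed
    then show "\<beta> / m + ((- 1 / m) *\<^sub>R n) \<bullet> q \<le> G q" using m by (simp add: field_simps)
  qed
qed

lemma convex_on_norm_diff: "convex_on UNIV (\<lambda>q. norm (q - p))"
  using convex_on_dist[of UNIV p] by (simp add: dist_norm norm_minus_commute)

text \<open>The downward cone of slope \<open>l\<close> with vertex (p, G p) lies below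
  \<open>G\<close>; an affine function between the two must pass through the vertex.\<close>

lemma lipschitz_convex_subgradient:
  fixes G :: "'a::euclidean_space \<Rightarrow> real"
  assumes G: "convex_on UNIV G" and l: "l \<ge> 0" "\<And>q. \<bar>G q - G p\<bar> \<le> l * dist q p"
  obtains v where "\<And>q. G p - v \<bullet> p + v \<bullet> q \<le> G q"
proof -
  have "convex_on UNIV (\<lambda>q. l * norm (q - p) + (- G p))"
    by (intro convex_on_add convex_on_cmul l convex_on_norm_diff) (simp add: convex_on_const)
  then have conc: "concave_on UNIV (\<lambda>q. G p - l * norm (q - p))"
    by (simp add: concave_on_def)
  have le: "G p - l * norm (q - p) \<le> G q" for q
    using l(2)[of q] by (simp add: dist_norm abs_le_iff)
  obtain a v where av: "\<And>q. G p - l * norm (q - p) \<le> a + v \<bullet> q" "\<And>q. a + v \<bullet> q \<le> G q"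
    using affine_sandwich[OF G conc le] by blast
  have "G p = a + v \<bullet> p" using av(1)[of p] av(2)[of p] by simp
  then show ?thesis using that[of v] av(2) by simp
qed

text \<open>The concave function a - \<gamma> + v . q - k |q| lies below \<open>G2\<close>, and an
  affine function separates them. Its value at 0 gives the bound on a', its growth at infinity the
  bound on v'.\<close>

lemma affine_minorant_transfer:
  fixes G1 G2 :: "'a::euclidean_space \<Rightarrow> real"
  assumes G2: "convex_on UNIV G2" and k: "k \<ge> 0"
    and G12: "\<And>q. G1 q - G2 q \<le> \<gamma> + k * norm q" and av: "\<And>q. a + v \<bullet> q \<le> G1 q"
  obtains a' v' where "a' \<ge> a - \<gamma>" "norm (v' - v) \<le> k" "\<And>q. a' + v' \<bullet> q \<le> G2 q"
proof -
  have "convex_on UNIV (\<lambda>q. - (v \<bullet> q))"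
    by (rule convex_onI) (auto simp: inner_add_right algebra_simps)
  then have "convex_on UNIV (\<lambda>q. k * norm (q - 0) + (- (v \<bullet> q) + (\<gamma> - a)))"
    by (intro convex_on_add convex_on_cmul k convex_on_norm_diff) (auto simp: convex_on_const)
  then have conc: "concave_on UNIV (\<lambda>q. (a - \<gamma>) + v \<bullet> q - k * norm q)"
    by (simp add: concave_on_def algebra_simps)
  have le: "(a - \<gamma>) + v \<bullet> q - k * norm q \<le> G2 q" for q
    using G12[of q] av[of q] by simp
  obtain a' v' where av': "\<And>q. (a - \<gamma>) + v \<bullet> q - k * norm q \<le> a' + v' \<bullet> q" "\<And>q. a' + v' \<bullet> q \<le> G2 q"
    using affine_sandwich[OF G2 conc le] by blast
  show ?thesis
  proof (rule that[of a' v'])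
    show "a' \<ge> a - \<gamma>" using av'(1)[of 0] by simp
    show "norm (v' - v) \<le> k"
    proof (rule ccontr)
      assume neg: "\<not> norm (v' - v) \<le> k"
      define n where "n = norm (v - v')"
      have n: "n > k" using neg by (simp add: n_def norm_minus_commute)
      \<comment> \<open>Far enough along v - v' that the excess slope n - k outweighs the difference
        of the constants by 1.\<close>
      define s where "s = (\<bar>a' - a + \<gamma>\<bar> + 1) / (n * (n - k))"
      have pos: "n * (n - k) > 0" using n k by simp
      have s: "s > 0" using pos by (simp add: s_def add_nonneg_pos)
      have "(a - \<gamma>) + v \<bullet> (s *\<^sub>R (v - v')) - k * norm (s *\<^sub>R (v - v')) \<le> a' + v' \<bullet> (s *\<^sub>R (v - v'))"
        by (rule av')
      then have "(a - \<gamma>) + s * (v \<bullet> (v - v')) - k * (s * n) \<le> a' + s * (v' \<bullet> (v - v'))"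
        using s by (simp add: n_def)
      then have "s * ((v - v') \<bullet> (v - v')) - k * (s * n) \<le> a' - a + \<gamma>" (is "s * ?vv - _ \<le> _")
        unfolding inner_diff_left[of v v' "v - v'"] by (simp add: algebra_simps)
      moreover have "?vv = n * n"
        by (simp add: n_def flip: power2_norm_eq_inner power2_eq_square)
      ultimately have "s * (n * n) - k * (s * n) \<le> a' - a + \<gamma>" by (simp only:)
      then have "s * (n * (n - k)) \<le> a' - a + \<gamma>" by (simp add: algebra_simps)
      moreover have "s * (n * (n - k)) = \<bar>a' - a + \<gamma>\<bar> + 1"
        unfolding s_def using pos by (intro nonzero_eq_divide_eq[THEN iffD1]) auto
      ultimately show False by linarith
    qed
  qed (rule av')
qed

subsection \<open>Moving infima of subsolutions\<close>

text \<open>Seen in the frame moving with velocity v, the term v . p of the minorant cancels the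
  transport term and leaves the rate -a. The Lipschitz bound confines the momenta to a ball, where
  continuity of H keeps the minorant valid near (y0,t0) up to \<theta>/2. The point of the statement
  is that \<delta> serves all starting points nearby: they will vary with h.\<close>

lemma subsolution_along_segments:
  fixes u :: "'a::euclidean_space \<Rightarrow> real \<Rightarrow> real"
  assumes Hcont: "continuous_on (UNIV \<times> {0..T} \<times> UNIV) (\<lambda>(x, t, p). H x t p)"
    and sub: "viscosity_sub T H u"
    and cu: "continuous_on (UNIV \<times> {0..<T}) (\<lambda>(x, t). u x t)"
    and \<Lambda>: "\<Lambda> > 0" and lip: "\<And>x y t. 0 < t \<Longrightarrow> t < T \<Longrightarrow> \<bar>u x t - u y t\<bar> \<le> \<Lambda> * dist x y"
    and t0: "0 < t0" "t0 < T" and av: "\<And>q. a + v \<bullet> q \<le> H y0 t0 q" and \<theta>: "\<theta> > 0"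
  obtains \<delta> where "\<delta> > 0"
    "\<And>y s h. dist y y0 < \<delta> \<Longrightarrow> dist s t0 < \<delta> \<Longrightarrow> 0 < h \<Longrightarrow> h < \<delta> \<Longrightarrow>
       u (y + h *\<^sub>R v) (s + h) \<le> u y s + h * (\<theta> - a)"
proof -
  define K3 where "K3 = cball y0 1 \<times> {0..T} \<times> cball (0::'a) (2 * \<Lambda>)"
  have "continuous_on K3 (\<lambda>(x, t, p). H x t p)"
    using Hcont by (elim continuous_on_subset) (auto simp: K3_def)
  moreover have "compact K3" by (auto simp: K3_def intro!: compact_Times)
  ultimately obtain \<eta> where \<eta>: "\<eta> > 0" and
    mod: "\<And>z z'. z \<in> K3 \<Longrightarrow> z' \<in> K3 \<Longrightarrow> dist z z' < \<eta> \<Longrightarrow> \<bar>(\<lambda>(x, t, p). H x t p) z - (\<lambda>(x, t, p). H x t p) z'\<bar> < \<theta> / 2"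
    using compact_modulus_of_continuity[of K3 "\<lambda>(x, t, p). H x t p" "\<theta> / 2"] \<theta> by auto
  \<comment> \<open>The maximum point found below satisfies |x - y0| + |t - t0| < (6 + 2|v|)
    \<delta>, and the times up to s + 2 h stay inside (0,T).\<close>
  define \<delta> where "\<delta> = min (min \<eta> 1 / (6 + 2 * norm v)) (min t0 (T - t0) / 4)"
  have nv: "6 + 2 * norm v > 0" by (simp add: add_pos_nonneg)
  have \<delta>1: "\<delta> \<le> min \<eta> 1 / (6 + 2 * norm v)" "\<delta> \<le> min t0 (T - t0) / 4"
    unfolding \<delta>_def by (rule min.cobounded1, rule min.cobounded2)
  have \<delta>: "\<delta> > 0" using nv \<eta> t0 by (simp add: \<delta>_def)
  have \<delta>2: "\<delta> * (6 + 2 * norm v) \<le> min \<eta> 1" using \<delta>1(1) nv by (simp add: pos_le_divide_eq)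
  have \<delta>3: "4 * \<delta> \<le> t0" "4 * \<delta> \<le> T - t0" using \<delta>1(2) by auto
  have near: "H x t p > a + v \<bullet> p - \<theta> / 2"
    if "dist x y0 + dist t t0 < 6 * \<delta> + 2 * norm v * \<delta>" "0 < t" "t < T" "norm p \<le> 2 * \<Lambda>" for x t p
  proof -
    have "dist x y0 + dist t t0 < min \<eta> 1" using that(1) \<delta>2 by (simp add: algebra_simps)
    moreover have "dist (x, t, p) (y0, t0, p) \<le> dist x y0 + dist t t0"
      using dist_Pair_le[of x "(t, p)" y0 "(t0, p)"] by (simp add: dist_Pair_Pair)
    ultimately have *: "dist (x, t, p) (y0, t0, p) < \<eta>" "dist x y0 \<le> 1"
      using zero_le_dist[of t t0] by linarith+
    have "\<bar>H x t p - H y0 t0 p\<bar> < \<theta> / 2"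
      using mod[of "(x, t, p)" "(y0, t0, p)"] * that t0 \<Lambda> by (auto simp: K3_def dist_commute)
    then show ?thesis using av[of p] by linarith
  qed
  have main: "u (y + h *\<^sub>R v) (s + h) \<le> u y s + h * (\<theta> - a)"
    if y: "dist y y0 < \<delta>" and s: "dist s t0 < \<delta>" and h: "0 < h" "h < \<delta>" for y s h
  proof (rule ccontr)
    assume neg: "\<not> u (y + h *\<^sub>R v) (s + h) \<le> u y s + h * (\<theta> - a)"
    define m where "m = \<theta> - a"
    define \<sigma> where "\<sigma> = (u (y + h *\<^sub>R v) (s + h) - u y s - h * m) / 2"
    have \<sigma>: "\<sigma> > 0" "u (y + h *\<^sub>R v) (s + h) = u y s + h * m + 2 * \<sigma>"
      using neg by (auto simp: \<sigma>_def m_def field_simps)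
    have sT: "0 < s" "s + 2 * h < T" using s h \<delta>3 by (auto simp: dist_real_def abs_less_iff)
    \<comment> \<open>A Lipschitz function gains at most \<Lambda>|\<xi>| against the penalty
      K|\<xi>|^2, so K|\<xi>| \<le> \<Lambda> at a maximum. The first summand then limits the gain
      at the initial time to \<sigma>, the second keeps |\<xi>| below \<delta>.\<close>
    define K where "K = \<Lambda>\<^sup>2 / \<sigma> + 2 * \<Lambda> / \<delta>"
    have K: "K > 0" using \<Lambda> \<sigma> \<delta> by (simp add: K_def add_pos_pos)
    have K1: "\<Lambda>\<^sup>2 \<le> K * \<sigma>" using \<Lambda> \<sigma> \<delta> by (simp add: K_def field_simps)
    have K2: "\<Lambda> < K * \<delta>"
    proof -
      have "K * \<delta> = \<Lambda>\<^sup>2 / \<sigma> * \<delta> + 2 * \<Lambda>" using \<delta> by (simp add: K_def field_simps)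
      moreover have "\<Lambda>\<^sup>2 / \<sigma> * \<delta> > 0" using \<Lambda> \<sigma> \<delta> by simp
      ultimately show ?thesis using \<Lambda> by linarith
    qed
    define D where "D = cball (0::'a) \<delta> \<times> {s..s + 2 * h}"
    have D: "compact D" by (auto simp: D_def intro!: compact_Times)
    define G where "G z = u (y + fst z + (snd z - s) *\<^sub>R v) (snd z) - m * (snd z - s)" for z
    have cG: "continuous_on D G"
      unfolding G_def
      by (intro continuous_intros continuous_on_compose2[OF cu, of _ "\<lambda>z. (y + fst z + (snd z - s) *\<^sub>R v, snd z)", simplified])
         (use sT in \<open>auto simp: D_def\<close>)
    obtain M where M: "M > 0" "\<And>z. z \<in> D \<Longrightarrow> \<bar>G z\<bar> \<le> M" using compact_bounded_abs[OF cG D] by blast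
    obtain k where k: "k > 0" "exp (- (k * (h / 2))) < \<sigma>" "2 * M + 1 \<le> exp (k * (h / 2))"
      using exp_rate[of "h / 2" \<sigma> "2 * M + 1"] h \<sigma> by auto
    \<comment> \<open>The window has length 2 h so that s + h, where the assumed excess sits, is
      interior. The exponential is below \<sigma> at s + h and at least 2 M + 1 at s + 2 h, which
      excludes the final time.\<close>
    define F where "F z = G z - K * (norm (fst z))\<^sup>2 - exp (k * (snd z - s - 3 / 2 * h))" for z
    have "continuous_on D F" unfolding F_def by (intro continuous_intros cG)
    moreover have "(0, s) \<in> D" using h \<delta> by (simp add: D_def)
    ultimately obtain z where z: "z \<in> D" and zmax: "\<And>z'. z' \<in> D \<Longrightarrow> F z' \<le> F z"
      using continuous_attains_sup[OF D, of F] by blast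
    obtain \<xi> t where zt: "z = (\<xi>, t)" by force
    have \<xi>t: "norm \<xi> \<le> \<delta>" "s \<le> t" "t \<le> s + 2 * h" using z by (auto simp: D_def zt)
    have tT: "0 < t" "t < T" using \<xi>t sT by auto
    have F1: "F (\<xi>, t) > u y s + \<sigma>"
    proof -
      have "exp (k * (s + h - s - 3 / 2 * h)) = exp (- (k * (h / 2)))" by (simp add: field_simps)
      then have "F (0, s + h) > u y s + \<sigma>" using \<sigma> k(2) by (simp add: F_def G_def)
      moreover have "(0, s + h) \<in> D" using h \<delta> by (simp add: D_def)
      ultimately show ?thesis using zmax zt by fastforce
    qed
    have Kxi: "K * norm \<xi> \<le> \<Lambda>"
    proof -
      have "F (0, t) \<le> F (\<xi>, t)" using zmax[of "(0, t)"] \<xi>t \<delta> zt by (simp add: D_def)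
      then have "K * (norm \<xi>)\<^sup>2 \<le> u (y + \<xi> + (t - s) *\<^sub>R v) t - u (y + (t - s) *\<^sub>R v) t"
        by (simp add: F_def G_def)
      also have "\<dots> \<le> \<Lambda> * norm \<xi>"
        using lip[OF tT, of "y + \<xi> + (t - s) *\<^sub>R v" "y + (t - s) *\<^sub>R v"] by (simp add: dist_norm abs_le_iff)
      finally have "norm \<xi> * (K * norm \<xi>) \<le> norm \<xi> * \<Lambda>" by (simp add: power2_eq_square algebra_simps)
      then show ?thesis using \<Lambda> by (cases "\<xi> = 0") auto
    qed
    have \<xi>\<delta>: "norm \<xi> < \<delta>" using Kxi K2 K
      by (metis le_less_trans mult_less_cancel_left_pos)
    have "t \<noteq> s"
    proof
      assume ts: "t = s"
      have "F (\<xi>, s) \<le> u (y + \<xi>) s - K * (norm \<xi>)\<^sup>2" by (simp add: F_def G_def)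
      also have "\<dots> \<le> u y s + \<Lambda> * norm \<xi>"
      proof -
        have "u (y + \<xi>) s - u y s \<le> \<Lambda> * norm \<xi>"
          using lip[of s "y + \<xi>" y] sT h by (simp add: dist_norm abs_le_iff)
        moreover have "0 \<le> K * (norm \<xi>)\<^sup>2" using K by simp
        ultimately show ?thesis by linarith
      qed
      also have "\<Lambda> * norm \<xi> \<le> \<sigma>"
      proof -
        have "K * (\<Lambda> * norm \<xi>) \<le> \<Lambda> * \<Lambda>" using mult_left_mono[OF Kxi, of \<Lambda>] \<Lambda> by (simp add: algebra_simps)
        also have "\<dots> \<le> K * \<sigma>" using K1 by (simp add: power2_eq_square)
        finally show ?thesis using K by simp
      qed
      finally show False using F1 ts by simp
    qed
    moreover have "t \<noteq> s + 2 * h"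
    proof
      assume th: "t = s + 2 * h"
      have e: "exp (k * (t - s - 3 / 2 * h)) = exp (k * (h / 2))" by (simp add: th field_simps)
      have "F (\<xi>, t) \<le> G (\<xi>, t) - exp (k * (t - s - 3 / 2 * h))" using K by (simp add: F_def)
      also have "\<dots> \<le> M - (2 * M + 1)" using M(2)[OF z] k(3) unfolding e zt by linarith
      also have "\<dots> < G (0, s)" using M(2)[OF \<open>(0, s) \<in> D\<close>] by (simp add: abs_le_iff)
      finally show False using F1 \<sigma> by (simp add: G_def)
    qed
    ultimately have t: "s < t" "t < s + 2 * h" using \<xi>t by auto
    define x where "x = y + \<xi> + (t - s) *\<^sub>R v"
    \<comment> \<open>X is the moving coordinate \<xi> as a function of space and time;
      differentiating the penalty in time produces -p . v with p = 2 K \<xi>.\<close>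
    define X where "X z = fst z - y - (snd z - s) *\<^sub>R v" for z :: "'a \<times> real"
    define \<phi> where "\<phi> z = m * (snd z - s) + K * (X z \<bullet> X z) + exp (k * (snd z - s - 3 / 2 * h))" for z
    define g where "g z = ((2 * K) *\<^sub>R X z, m - 2 * K * (X z \<bullet> v) + k * exp (k * (snd z - s - 3 / 2 * h)))" for z
    have "(\<phi> has_derivative (\<lambda>h. g z \<bullet> h)) (at z)" for z
      unfolding \<phi>_def X_def g_def
      by (rule derivative_eq_intros refl | simp)+
         (auto simp: fun_eq_iff inner_diff_left inner_diff_right inner_commute algebra_simps)
    then have C1: "C1_with_grad UNIV \<phi> g"
      unfolding C1_with_grad_def g_def X_def by (auto intro!: continuous_intros)
    have Xx: "X (x, t) = \<xi>" by (simp add: X_def x_def)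
    define O' where "O' = {z. norm (X z) < \<delta> \<and> s < snd z \<and> snd z < s + 2 * h}"
    have "open O'" unfolding O'_def X_def by (intro open_Collect_conj open_Collect_less continuous_intros)
    moreover have "(x, t) \<in> O'" using Xx \<xi>\<delta> t by (simp add: O'_def)
    ultimately obtain \<epsilon> where \<epsilon>: "\<epsilon> > 0" "\<And>z. dist z (x, t) < \<epsilon> \<Longrightarrow> z \<in> O'" unfolding open_dist by blast
    have F\<phi>: "F (X (x', t'), t') = u x' t' - \<phi> (x', t')" for x' t'
      by (simp add: F_def G_def \<phi>_def X_def power2_norm_eq_inner)
    have "snd (g (x, t)) + H x t (fst (g (x, t))) \<le> 0"
    proof (rule viscosity_subD[OF sub C1 tT \<epsilon>(1)])
      fix x' t' assume "dist (x', t') (x, t) < \<epsilon>"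
      then have "(x', t') \<in> O'" using \<epsilon> by blast
      then have "(X (x', t'), t') \<in> D" by (simp add: O'_def D_def)
      then have "F (X (x', t'), t') \<le> F (X (x, t), t)" using zmax by (simp add: zt Xx)
      then show "u x' t' - \<phi> (x', t') \<le> u x t - \<phi> (x, t)" by (simp add: F\<phi>)
    qed
    then have I: "m - 2 * K * (\<xi> \<bullet> v) + k * exp (k * (t - s - 3 / 2 * h)) + H x t ((2 * K) *\<^sub>R \<xi>) \<le> 0"
      by (simp add: g_def Xx)
    have "dist x y0 + dist t t0 < 6 * \<delta> + 2 * norm v * \<delta>"
    proof -
      have "dist x y0 \<le> norm \<xi> + norm ((t - s) *\<^sub>R v) + dist y y0"
        using norm_triangle_ineq[of "\<xi> + (t - s) *\<^sub>R v" "y - y0"] norm_triangle_ineq[of \<xi> "(t - s) *\<^sub>R v"]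
        unfolding x_def dist_norm by (simp add: algebra_simps)
      moreover have "norm ((t - s) *\<^sub>R v) \<le> 2 * norm v * \<delta>"
        using t h mult_right_mono[of "t - s" "2 * \<delta>" "norm v"] unfolding norm_scaleR by (simp add: algebra_simps)
      moreover have "dist t t0 < 3 * \<delta>" using s t h by (auto simp: dist_real_def abs_less_iff)
      ultimately show ?thesis using \<xi>\<delta> y \<delta> by linarith
    qed
    then have "H x t ((2 * K) *\<^sub>R \<xi>) > a + v \<bullet> ((2 * K) *\<^sub>R \<xi>) - \<theta> / 2"
      by (rule near) (use tT Kxi K in auto)
    moreover have "k * exp (k * (t - s - 3 / 2 * h)) > 0" using k by simp
    ultimately show False using I \<theta> by (simp add: m_def inner_commute)
  qed
  show ?thesis by (rule that[OF \<delta> main])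
qed

text \<open>A minimiser belonging to time t - h and centre x - h v is carried by v' to within R =
  r(t - h) + h C r(t) of x. Since r' = C r, R differs from r(t) by o(h), so rescaling the carried
  point into the ball of radius r(t) costs only \<Lambda> o(h). Division by h and h -> 0 give the
  differential inequality.\<close>

lemma inf_ball_subsolution:
  fixes u :: "'a::euclidean_space \<Rightarrow> real \<Rightarrow> real"
  assumes C: "C \<ge> 0" and b: "\<And>t. b t \<ge> 0" and r0: "r0 > 0"
    and A: "A \<ge> 0" and B: "B \<ge> 0"
    and Hcont: "continuous_on (UNIV \<times> {0..T} \<times> UNIV) (\<lambda>(x, t, p). H x t p)"
    and Hx: "\<And>x y t p. t \<in> {0..T} \<Longrightarrow> \<bar>H x t p - H y t p\<bar> \<le> C * (b t + norm p) * dist x y"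
    and Hp: "\<And>x t p q. t \<in> {0..T} \<Longrightarrow> \<bar>H x t p - H x t q\<bar> \<le> (A * norm x + B) * dist p q"
    and Hconv: "\<And>x t. t \<in> {0..T} \<Longrightarrow> convex_on UNIV (H x t)"
    and sub: "viscosity_sub T H u"
    and cu: "continuous_on (UNIV \<times> {0..<T}) (\<lambda>(x, t). u x t)"
    and \<Lambda>: "\<Lambda> > 0" and lip: "\<And>x y t. 0 < t \<Longrightarrow> t < T \<Longrightarrow> \<bar>u x t - u y t\<bar> \<le> \<Lambda> * dist x y"
    and c: "\<And>s. (c has_real_derivative - C * b s * (r0 * exp (C * s))) (at s)"
  shows "viscosity_sub T H (\<lambda>x t. inf_ball u (\<lambda>t. r0 * exp (C * t)) x t + c t)"
    (is "viscosity_sub T H ?w")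
  unfolding viscosity_sub_def
proof (intro allI impI)
  fix \<phi> :: "'a \<times> real \<Rightarrow> real" and g x t
  assume \<phi>: "C1_with_grad (UNIV \<times> {0<..<T}) \<phi> g" and t: "0 < t" "t < T"
  assume "\<exists>e>0. \<forall>y s. dist (y, s) (x, t) < e \<and> 0 < s \<and> s < T \<longrightarrow> ?w y s - \<phi> (y, s) \<le> ?w x t - \<phi> (x, t)"
  then obtain e1 where e1: "e1 > 0"
    and max: "\<And>y s. dist (y, s) (x, t) < e1 \<Longrightarrow> 0 < s \<Longrightarrow> s < T \<Longrightarrow> ?w y s - \<phi> (y, s) \<le> ?w x t - \<phi> (x, t)"
    by blast
  define r where "r = (\<lambda>t. r0 * exp (C * t))"
  have rpos: "r s > 0" for s using r0 by (simp add: r_def)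
  have rd: "(r has_real_derivative C * r s) (at s)" for s
    unfolding r_def by (auto intro!: derivative_eq_intros)
  have tT: "t \<in> {0..T}" using t by simp
  define p where "p = fst (g (x, t))"
  (* v is an optimal velocity for p at (x, t); stepping backwards along it compares w at (x, t) with w at
     (x - h v, t - h), whose minimiser is then transported forwards with the velocity v' allowed at y0. *)
  obtain v where v: "\<And>q. H x t p - v \<bullet> p + v \<bullet> q \<le> H x t q"
    using lipschitz_convex_subgradient[OF Hconv[OF tT], of "A * norm x + B" x p] Hp[OF tT] A B by auto
  define a where "a = H x t p - v \<bullet> p"
  define hs where "hs n = t / 2 * inverse (real (Suc n))" for n :: nat
  have hs: "0 < hs n" "hs n < t" for n using t by (auto simp: hs_def field_simps add_pos_nonneg)
  have hs0: "hs \<longlonglongrightarrow> 0" unfolding hs_def by (intro tendsto_mult_right_zero LIMSEQ_inverse_real_of_nat)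
  have "\<exists>e. norm e \<le> 1 \<and> inf_ball u r (x - hs n *\<^sub>R v) (t - hs n)
      = u (x - hs n *\<^sub>R v + r (t - hs n) *\<^sub>R e) (t - hs n)" for n
    by (rule inf_ball_attained[OF cu, of "t - hs n" r "x - hs n *\<^sub>R v"]) (use hs[of n] t in auto)
  then obtain es where es: "\<And>n. norm (es n) \<le> 1"
    "\<And>n. inf_ball u r (x - hs n *\<^sub>R v) (t - hs n) = u (x - hs n *\<^sub>R v + r (t - hs n) *\<^sub>R es n) (t - hs n)"
    by metis
  \<comment> \<open>The minimisers vary with h, but the velocity v' and the range of admissible
    steps depend on the base point y0. Passing to a convergent subsequence of offsets fixes y0
    beforehand.\<close>
  have "seq_compact (cball (0::'a) 1)" by (simp add: compact_imp_seq_compact)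
  then obtain e0 \<tau> where e0: "norm e0 \<le> 1" and \<tau>: "strict_mono \<tau>" and lim: "(es \<circ> \<tau>) \<longlonglongrightarrow> e0"
    using es(1) unfolding seq_compact_def by (metis dist_0_norm mem_cball)
  define hh where "hh n = hs (\<tau> n)" for n
  define ee where "ee n = es (\<tau> n)" for n
  have hh: "0 < hh n" "hh n < t" for n using hs by (auto simp: hh_def)
  have hh0: "hh \<longlonglongrightarrow> 0" using LIMSEQ_subseq_LIMSEQ[OF hs0 \<tau>] by (simp add: hh_def[abs_def] o_def)
  have ee: "norm (ee n) \<le> 1" "ee \<longlonglongrightarrow> e0" for n using es lim by (auto simp: ee_def[abs_def] o_def)
  define y0 where "y0 = x + r t *\<^sub>R e0"
  have dxy: "dist x y0 \<le> r t" using e0 rpos[of t] by (simp add: y0_def dist_norm mult_left_le)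
  have G12: "H x t q - H y0 t q \<le> C * b t * r t + (C * r t) * norm q" for q
  proof -
    have "H x t q - H y0 t q \<le> C * (b t + norm q) * dist x y0" using Hx[OF tT] by (simp add: abs_le_iff)
    also have "\<dots> \<le> C * (b t + norm q) * r t" using dxy C b[of t] by (intro mult_left_mono) auto
    finally show ?thesis by (simp add: algebra_simps)
  qed
  obtain a' v' where a': "a' \<ge> a - C * b t * r t" and v': "norm (v' - v) \<le> C * r t"
    and av': "\<And>q. a' + v' \<bullet> q \<le> H y0 t q"
    using affine_minorant_transfer[OF Hconv[OF tT] _ G12, of a v] v C rpos[of t]
    by (auto simp: a_def)
  \<comment> \<open>\<open>f3 h\<close> bounds the distance of the carried point from x; its
    derivative at 0 is -r' + C r = 0.\<close>
  define f3 where "f3 h = r (t - h) + h * (C * r t)" for h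
  have D3: "(f3 has_real_derivative 0) (at 0)"
    unfolding f3_def r_def by (auto intro!: derivative_eq_intros)
  have D2: "((\<lambda>h. c (t - h)) has_real_derivative C * b t * r t) (at 0)"
  proof -
    have "((\<lambda>h. t - h) has_real_derivative - 1) (at 0)" by (auto intro!: derivative_eq_intros)
    from DERIV_chain2[OF c this] show ?thesis by (simp add: r_def)
  qed
  have D1: "((\<lambda>h. \<phi> (x + h *\<^sub>R (- v), t + h * (- 1))) has_real_derivative - (snd (g (x, t)) + v \<bullet> p)) (at 0)"
    using C1_with_grad_directional[OF \<phi>, of x t "- v" "- 1"] t
    by (simp add: p_def inner_prod_def inner_commute add.commute)
  have quot: "(\<lambda>n. (f (hh n) - f 0) / hh n) \<longlonglongrightarrow> D" if "(f has_real_derivative D) (at 0)" for f D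
  proof -
    have "((\<lambda>h. (f (0 + h) - f 0) / h) \<longlongrightarrow> D) (at 0)" using that by (simp add: DERIV_def)
    moreover have "filterlim hh (at 0) sequentially"
      unfolding filterlim_at using hh0 hh(1) by (auto intro!: always_eventually simp: less_imp_neq[symmetric])
    ultimately show ?thesis using filterlim_compose by fastforce
  qed
  have le: "snd (g (x, t)) + H x t p \<le> \<theta>" if \<theta>: "\<theta> > 0" for \<theta>
  proof -
    obtain \<delta> where \<delta>: "\<delta> > 0" and seg: "\<And>y s h. dist y y0 < \<delta> \<Longrightarrow> dist s t < \<delta> \<Longrightarrow> 0 < h \<Longrightarrow> h < \<delta> \<Longrightarrow>
       u (y + h *\<^sub>R v') (s + h) \<le> u y s + h * (\<theta> - a')"
      using subsolution_along_segments[OF Hcont sub cu \<Lambda> lip t av' \<theta>] by blast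
    define yy where "yy n = x - hh n *\<^sub>R v + r (t - hh n) *\<^sub>R ee n" for n
    have rc: "isCont r t" using rd DERIV_isCont by blast
    have "(\<lambda>n. t - hh n) \<longlonglongrightarrow> t - 0" by (intro tendsto_intros hh0)
    then have "(\<lambda>n. r (t - hh n)) \<longlonglongrightarrow> r t" using isCont_tendsto_compose[OF rc] by simp
    then have "yy \<longlonglongrightarrow> x - 0 *\<^sub>R v + r t *\<^sub>R e0"
      unfolding yy_def by (intro tendsto_intros hh0 ee)
    then have "yy \<longlonglongrightarrow> y0" by (simp add: y0_def)
    then have ev1: "\<forall>\<^sub>F n in sequentially. dist (yy n) y0 < \<delta>" using \<delta> by (rule tendstoD)
    have ev2: "\<forall>\<^sub>F n in sequentially. dist (hh n) 0 < \<delta>" using hh0 \<delta> by (rule tendstoD)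
    have "(\<lambda>n. (x + hh n *\<^sub>R (- v), t + hh n * (- 1))) \<longlonglongrightarrow> (x + 0 *\<^sub>R (- v), t + 0 * (- 1))"
      by (intro tendsto_intros hh0)
    then have ev3: "\<forall>\<^sub>F n in sequentially. dist (x + hh n *\<^sub>R (- v), t + hh n * (- 1)) (x, t) < e1"
      using e1 tendstoD by fastforce
    have ev: "\<forall>\<^sub>F n in sequentially.
        - ((\<phi> (x + hh n *\<^sub>R (- v), t + hh n * (- 1)) - \<phi> (x + 0 *\<^sub>R (- v), t + 0 * (- 1))) / hh n)
          \<le> - ((c (t - hh n) - c (t - 0)) / hh n) + (\<theta> - a') + \<Lambda> * \<bar>(f3 (hh n) - f3 0) / hh n\<bar>"
      using ev1 ev2 ev3
    proof eventually_elim
      case (elim n)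
      define h where "h = hh n"
      have h: "0 < h" "h < t" "h < \<delta>" using hh[of n] elim by (auto simp: h_def)
      have 1: "?w (x - h *\<^sub>R v) (t - h) - \<phi> (x - h *\<^sub>R v, t - h) \<le> ?w x t - \<phi> (x, t)"
        using max[of "x - h *\<^sub>R v" "t - h"] elim h t by (simp add: h_def)
      have 2: "u (yy n + h *\<^sub>R v') t \<le> u (yy n) (t - h) + h * (\<theta> - a')"
        using seg[of "yy n" "t - h" h] elim h by (simp add: dist_real_def)
      have 3: "inf_ball u r (x - h *\<^sub>R v) (t - h) = u (yy n) (t - h)"
        using es(2)[of "\<tau> n"] by (simp add: yy_def h_def hh_def ee_def)
      define z where "z = yy n + h *\<^sub>R v' - x"
      define R where "R = f3 h"
      have R: "R > 0" using rpos[of "t - h"] rpos[of t] C h by (simp add: R_def f3_def add_pos_nonneg)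
      have zR: "norm z \<le> R"
      proof -
        have "z = h *\<^sub>R (v' - v) + r (t - h) *\<^sub>R ee n"
          by (simp add: z_def yy_def h_def algebra_simps)
        then have "norm z \<le> norm (h *\<^sub>R (v' - v)) + norm (r (t - h) *\<^sub>R ee n)"
          by (simp only: norm_triangle_ineq)
        also have "\<dots> \<le> h * (C * r t) + r (t - h)"
          using v' h ee(1)[of n] rpos[of "t - h"] by (intro add_mono) (auto simp: mult_left_le mult_left_mono)
        finally show ?thesis by (simp add: R_def f3_def)
      qed
      have "inf_ball u r x t \<le> u (x + r t *\<^sub>R ((1 / R) *\<^sub>R z)) t"
        by (rule inf_ball_le[OF cu]) (use t zR R in \<open>auto simp: field_simps\<close>)
      also have "\<dots> \<le> u (x + z) t + \<Lambda> * norm (r t *\<^sub>R ((1 / R) *\<^sub>R z) - z)"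
        using lip[OF t, of "x + r t *\<^sub>R ((1 / R) *\<^sub>R z)" "x + z"] by (simp add: dist_norm abs_le_iff)
      also have "norm (r t *\<^sub>R ((1 / R) *\<^sub>R z) - z) \<le> \<bar>R - r t\<bar>"
      proof -
        have "r t *\<^sub>R ((1 / R) *\<^sub>R z) - z = ((r t - R) / R) *\<^sub>R z"
          using R by (simp add: diff_divide_distrib scaleR_diff_left)
        then have "norm (r t *\<^sub>R ((1 / R) *\<^sub>R z) - z) = \<bar>r t - R\<bar> * (norm z / R)" using R by simp
        also have "\<dots> \<le> \<bar>r t - R\<bar> * 1" using zR R by (intro mult_left_mono) auto
        finally show ?thesis by (simp add: abs_minus_commute)
      qed
      finally have 4: "inf_ball u r x t \<le> u (yy n + h *\<^sub>R v') t + \<Lambda> * \<bar>R - r t\<bar>"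
        using \<Lambda> by (simp add: z_def)
      have "\<phi> (x, t) - \<phi> (x - h *\<^sub>R v, t - h) \<le> c t - c (t - h) + h * (\<theta> - a') + \<Lambda> * \<bar>R - r t\<bar>"
        using 1 2 3 4 unfolding r_def[symmetric] by linarith
      then have "(\<phi> (x, t) - \<phi> (x - h *\<^sub>R v, t - h)) / h \<le> (c t - c (t - h) + h * (\<theta> - a') + \<Lambda> * \<bar>R - r t\<bar>) / h"
        using h by (intro divide_right_mono) auto
      also have "\<dots> = (c t - c (t - h)) / h + (\<theta> - a') + \<Lambda> * \<bar>(f3 h - f3 0) / h\<bar>"
        using h by (simp add: add_divide_distrib R_def f3_def)
      finally show ?case by (simp add: h_def[symmetric] minus_divide_left)
    qed
    \<comment> \<open>The limit reads phi_t + v . p \<le> -C b r + \<theta> - a'. The loss a' \<ge>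
      a - C b r cancels the contribution of c, and a + v . p = H(x,t,p).\<close>
    have "- (- (snd (g (x, t)) + v \<bullet> p)) \<le> - (C * b t * r t) + (\<theta> - a') + \<Lambda> * \<bar>0\<bar>"
      by (rule tendsto_le[OF sequentially_bot _ _ ev])
         (intro tendsto_intros quot D1 D2 D3)+
    then show ?thesis using a' by (simp add: a_def)
  qed
  show "snd (g (x, t)) + H x t (fst (g (x, t))) \<le> 0"
  proof (rule field_le_epsilon)
    fix \<theta> :: real assume "\<theta> > 0"
    from le[OF this] show "snd (g (x, t)) + H x t (fst (g (x, t))) \<le> 0 + \<theta>" by (simp add: p_def)
  qed
qed

subsection \<open>Propagation of the lower slope bound\<close>

text \<open>If f dropped by less than \<eta> r, adding \<eta> times a smoothed distance to x would
  create an interior minimum on the ball. The smoothed distance has gradient of norm below 1, so f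
  would have a subgradient of norm below \<eta> there.\<close>

lemma decrease_principle:
  fixes f :: "'a::euclidean_space \<Rightarrow> real"
  assumes f: "continuous_on UNIV f" and r: "r > 0" and \<eta>: "\<eta> \<ge> 0"
    and sd: "\<And>y p. dist y x \<le> r \<Longrightarrow> p \<in> subdiff f y \<Longrightarrow> \<eta> \<le> norm p"
  obtains y where "dist y x \<le> r" "f y \<le> f x - \<eta> * r"
proof (cases "\<eta> = 0")
  case True
  then show ?thesis using that[of x] r by simp
next
  case False
  then have \<eta>: "\<eta> > 0" using \<eta> by simp
  have cf: "continuous_on (cball x r) f" using f continuous_on_subset by blast
  then obtain ym where ym: "ym \<in> cball x r" "\<And>y. y \<in> cball x r \<Longrightarrow> f ym \<le> f y"
    using continuous_attains_inf[of "cball x r" f] r by auto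
  have "f ym \<le> f x - \<eta> * r"
  proof (rule ccontr)
    assume neg: "\<not> f ym \<le> f x - \<eta> * r"
    define \<gamma> where "\<gamma> = f ym - (f x - \<eta> * r)"
    have \<gamma>: "\<gamma> > 0" using neg by (simp add: \<gamma>_def)
    \<comment> \<open>The smoothing costs \<eta> e = \<gamma>/2 at the centre, less than the deficit
      \<gamma> that any boundary point has.\<close>
    define e where "e = \<gamma> / (2 * \<eta>)"
    have e: "e > 0" using \<gamma> \<eta> by (simp add: e_def)
    define q where "q y = sqrt (inner (y - x) (y - x) + e\<^sup>2)" for y
    have q: "norm (y - x) < q y" for y
      unfolding q_def norm_eq_sqrt_inner using e by simp
    have q0: "q y > 0" for y using q[of y] norm_ge_zero[of "y - x"] by linarith
    have C1: "C1_with_grad UNIV q (\<lambda>y. (1 / q y) *\<^sub>R (y - x))"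
      using C1_with_grad_smooth_norm[OF e, of x] by (simp add: q_def[abs_def])
    then have cq: "continuous_on UNIV q"
      unfolding C1_with_grad_def by (meson continuous_at_imp_continuous_on has_derivative_continuous)
    then have "continuous_on (cball x r) (\<lambda>y. f y + \<eta> * q y)"
      by (intro continuous_intros cf) (auto elim: continuous_on_subset)
    then obtain y1 where y1: "y1 \<in> cball x r" "\<And>y. y \<in> cball x r \<Longrightarrow> f y1 + \<eta> * q y1 \<le> f y + \<eta> * q y"
      using continuous_attains_inf[of "cball x r" "\<lambda>y. f y + \<eta> * q y"] r by auto
    have "dist y1 x < r"
    proof (rule ccontr)
      assume "\<not> dist y1 x < r"
      then have "norm (y1 - x) \<ge> r" by (simp add: dist_norm)
      then have "\<eta> * r \<le> \<eta> * q y1" using q[of y1] \<eta> by (intro mult_left_mono) auto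
      moreover have "f ym \<le> f y1" using ym y1 by blast
      moreover have "f y1 + \<eta> * q y1 \<le> f x + \<eta> * q x" using y1(2)[of x] r by simp
      moreover have "\<eta> * q x = \<gamma> / 2" using \<gamma> \<eta> by (simp add: q_def e_def)
      moreover have "f ym = f x - \<eta> * r + \<gamma>" by (simp add: \<gamma>_def)
      ultimately show False using \<gamma> by (simp add: field_simps)
    qed
    have CC: "C1_with_grad UNIV (\<lambda>y. - (\<eta> * q y)) (\<lambda>y. - (\<eta> / q y) *\<^sub>R (y - x))"
      using C1 unfolding C1_with_grad_def
      by (auto intro!: derivative_eq_intros continuous_intros cq simp: less_imp_neq[OF q0, symmetric])
    have "- (\<eta> / q y1) *\<^sub>R (y1 - x) \<in> subdiff f y1"
      unfolding subdiff_def mem_Collect_eq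
    proof (intro exI conjI allI impI)
      show "- (\<eta> / q y1) *\<^sub>R (y1 - x) = (\<lambda>y. - (\<eta> / q y) *\<^sub>R (y - x)) y1" ..
      show "r - dist y1 x > 0" using \<open>dist y1 x < r\<close> by simp
      fix w assume "dist w y1 < r - dist y1 x"
      then have "w \<in> cball x r" using dist_triangle[of x w y1] by (simp add: dist_commute)
      then show "f y1 - (- (\<eta> * q y1)) \<le> f w - (- (\<eta> * q w))" using y1(2) by simp
    qed (rule CC)
    then have "\<eta> \<le> norm (- (\<eta> / q y1) *\<^sub>R (y1 - x))" using sd \<open>dist y1 x < r\<close> by (meson less_imp_le)
    also have "\<dots> = \<eta> * (norm (y1 - x) / q y1)" using \<eta> q0[of y1] by simp
    also have "\<dots> < \<eta> * 1" using \<eta> q[of y1] q0[of y1] by (intro mult_strict_left_mono) auto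
    finally show False by simp
  qed
  then show ?thesis using that[of ym] ym by (simp add: dist_commute)
qed

text \<open>W \<le> u at (x,t) says that u(.,t) drops by c(t) within distance r(t) of x, while the
  one-sided slope P allows a drop of at most (P + \<epsilon>) r(t). \<open>J\<close> is an abstract
  primitive of b(s) e^(C s), so that c(t) = r0 (\<eta> - C J(t)) has the derivative the moving
  infimum demands.\<close>

lemma lower_slope_propagation:
  fixes u :: "'a::euclidean_space \<Rightarrow> real \<Rightarrow> real"
  assumes C: "C \<ge> 0" and b: "\<And>t. b t \<ge> 0" and b': "\<And>t. t \<in> {0..T} \<Longrightarrow> b t \<le> b'"
    and A: "A \<ge> 0" and B: "B \<ge> 0"
    and Hcont: "continuous_on (UNIV \<times> {0..T} \<times> UNIV) (\<lambda>(x, t, p). H x t p)"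
    and Hx: "\<And>x y t p. t \<in> {0..T} \<Longrightarrow> \<bar>H x t p - H y t p\<bar> \<le> C * (b t + norm p) * dist x y"
    and Hp: "\<And>x t p q. t \<in> {0..T} \<Longrightarrow> \<bar>H x t p - H x t q\<bar> \<le> (A * norm x + B) * dist p q"
    and Hconv: "\<And>x t. t \<in> {0..T} \<Longrightarrow> convex_on UNIV (H x t)"
    and sub: "viscosity_sub T H u" and super: "viscosity_super T H u"
    and cu: "continuous_on (UNIV \<times> {0..<T}) (\<lambda>(x, t). u x t)"
    and L: "L-lipschitz_on UNIV (\<lambda>x. u x 0)"
    and J: "J 0 = 0" "\<And>s. (J has_real_derivative b s * exp (C * s)) (at s)"
    and t: "0 < t" "t < T" and \<delta>: "\<delta> > 0" and \<eta>: "\<eta> \<ge> 0"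
    and low: "\<And>y p. dist y x \<le> Rfun A B x t + \<delta> \<Longrightarrow> p \<in> subdiff (\<lambda>x. u x 0) y \<Longrightarrow> \<eta> \<le> norm p"
    and P: "P \<ge> 0" "\<And>\<epsilon>. \<epsilon> > 0 \<Longrightarrow> \<exists>\<rho>>0. \<forall>y. dist y x < \<rho> \<longrightarrow> u x t - (P + \<epsilon>) * dist y x \<le> u y t"
  shows "exp (- C * t) * (\<eta> - C * J t) \<le> P"
proof (rule field_le_epsilon)
  fix \<epsilon> :: real assume \<epsilon>: "\<epsilon> > 0"
  have b'0: "b' \<ge> 0" using b[of 0] b'[of 0] t by simp
  \<comment> \<open>Comparison and the Lipschitz estimate are stated for a constant b and use the
    bound b'; the exact b(t) enters only through c.\<close>
  have Hx': "\<bar>H x t p - H y t p\<bar> \<le> C * (b' + norm p) * dist x y" if "t \<in> {0..T}" for x y t p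
  proof -
    have "C * (b t + norm p) * dist x y \<le> C * (b' + norm p) * dist x y"
      using C b'[OF that] by (intro mult_right_mono mult_left_mono) auto
    then show ?thesis using Hx[OF that, of x p y] by linarith
  qed
  have L': "L \<ge> 0" "\<And>x y. \<bar>u x 0 - u y 0\<bar> \<le> L * dist x y"
    using L by (auto simp: lipschitz_on_def dist_real_def)
  obtain \<Lambda> where \<Lambda>: "\<Lambda> > 0" and lip: "\<And>x y t. 0 < t \<Longrightarrow> t < T \<Longrightarrow> \<bar>u x t - u y t\<bar> \<le> \<Lambda> * dist x y"
    using solution_lipschitz[OF A B C b'0 Hcont Hx' Hp sub super cu L'] by blast
  obtain \<rho> where \<rho>: "\<rho> > 0" "\<And>y. dist y x < \<rho> \<Longrightarrow> u x t - (P + \<epsilon>) * dist y x \<le> u y t"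
    using P(2)[OF \<epsilon>] by blast
  \<comment> \<open>The first bound keeps the balls around points of the initial cone inside the
    region where \<eta> is known; the second makes r(t) < \<rho>, the range of the slope
    estimate.\<close>
  define r0 where "r0 = min (\<delta> / 2) (\<rho> * exp (- C * t) / 2)"
  have r0: "r0 > 0" using \<delta> \<rho> by (simp add: r0_def)
  have r0le: "r0 \<le> \<delta> / 2" "r0 \<le> \<rho> * exp (- C * t) / 2"
    unfolding r0_def by (rule min.cobounded1, rule min.cobounded2)
  define r where "r = (\<lambda>t. r0 * exp (C * t))"
  define c where "c = (\<lambda>t. r0 * (\<eta> - C * J t))"
  define W where "W = (\<lambda>x t. inf_ball u r x t + c t)"
  have rt: "r t < \<rho>"
  proof -
    have "r t \<le> \<rho> * exp (- C * t) / 2 * exp (C * t)" unfolding r_def using r0le(2) by (intro mult_right_mono) auto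
    also have "\<dots> = \<rho> / 2" by (simp add: exp_minus)
    finally show ?thesis using \<rho> by simp
  qed
  have rt0: "r t > 0" using r0 by (simp add: r_def)
  have cd: "(c has_real_derivative - C * b s * (r0 * exp (C * s))) (at s)" for s
    unfolding c_def by (auto intro!: derivative_eq_intros J)
  have subW: "viscosity_sub T H W"
    using inf_ball_subsolution[OF C b r0 A B Hcont Hx Hp Hconv sub cu \<Lambda> lip cd] by (simp add: W_def r_def)
  have "continuous_on (UNIV \<times> {0..<T}) (\<lambda>(x, t). inf_ball u r x t)"
    by (rule continuous_on_inf_ball[OF cu]) (auto simp: r_def intro!: continuous_intros)
  moreover have "continuous_on UNIV c"
    using cd by (meson DERIV_isCont continuous_at_imp_continuous_on)
  then have "continuous_on (UNIV \<times> {0..<T}) (\<lambda>z::'a \<times> real. c (snd z))"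
    by (rule continuous_on_compose2) (auto intro!: continuous_intros)
  ultimately have cW: "continuous_on (UNIV \<times> {0..<T}) (\<lambda>(x, t). W x t)"
    unfolding W_def case_prod_unfold by (rule continuous_on_add)
  have "W z 0 \<le> u z 0" if z: "dist z x < Rfun A B x t + \<delta> / 2" for z
  proof -
    have "continuous_on UNIV (\<lambda>x. u x 0)" using L by (rule lipschitz_on_continuous_on)
    moreover have "\<eta> \<le> norm p" if "dist y z \<le> r0" "p \<in> subdiff (\<lambda>x. u x 0) y" for y p
      using low[of y p] that dist_triangle[of y x z] z r0le(1) by simp
    ultimately obtain y where y: "dist y z \<le> r0" "u y 0 \<le> u z 0 - \<eta> * r0"
      using decrease_principle[of "\<lambda>x. u x 0" r0 \<eta> z] r0 \<eta> by blast
    have "inf_ball u r z 0 \<le> u (z + r 0 *\<^sub>R ((1 / r0) *\<^sub>R (y - z))) 0"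
      by (rule inf_ball_le[OF cu]) (use t r0 y in \<open>auto simp: dist_norm\<close>)
    also have "\<dots> = u y 0" using r0 by (simp add: r_def)
    finally show ?thesis using y by (simp add: W_def c_def J algebra_simps)
  qed
  then have "W x t \<le> u x t"
    by (intro viscosity_comparison[OF A B C b'0 Hcont Hx' Hp subW super cW cu t, of "\<delta> / 2"]) (use \<delta> in auto)
  moreover obtain e where e: "norm e \<le> 1" "inf_ball u r x t = u (x + r t *\<^sub>R e) t"
    by (rule inf_ball_attained[OF cu, of t r x]) (use t in auto)
  moreover have "u x t - (P + \<epsilon>) * r t \<le> u (x + r t *\<^sub>R e) t"
  proof -
    have d: "dist (x + r t *\<^sub>R e) x \<le> r t" using e rt0 by (simp add: dist_norm mult_left_le)
    then have "(P + \<epsilon>) * dist (x + r t *\<^sub>R e) x \<le> (P + \<epsilon>) * r t" using P \<epsilon> by (intro mult_left_mono) auto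
    then show ?thesis using \<rho>(2)[of "x + r t *\<^sub>R e"] d rt by simp
  qed
  ultimately have "c t \<le> (P + \<epsilon>) * r t" by (simp add: W_def)
  then have "r0 * (\<eta> - C * J t) \<le> r0 * ((P + \<epsilon>) * exp (C * t))" by (simp add: c_def r_def algebra_simps)
  then have "\<eta> - C * J t \<le> (P + \<epsilon>) * exp (C * t)" using r0 by simp
  then show "exp (- C * t) * (\<eta> - C * J t) \<le> P + \<epsilon>"
    by (simp add: exp_minus inverse_eq_divide pos_divide_le_eq)
qed

section \<open>Removal of the zero-order term and passage to extended reals\<close>

lemma C1_with_grad_exp_time:
  fixes \<phi> :: "'a::euclidean_space \<times> real \<Rightarrow> real"
  assumes "C1_with_grad S \<phi> g"
  shows "C1_with_grad S (\<lambda>z. exp (- lam * snd z) * (\<phi> z + k))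
     (\<lambda>z. exp (- lam * snd z) *\<^sub>R g z - (0, lam * exp (- lam * snd z) * (\<phi> z + k)))"
proof -
  have d: "(\<phi> has_derivative (\<lambda>h. g z \<bullet> h)) (at z)" if "z \<in> S" for z
    using assms that by (simp add: C1_with_grad_def)
  then have "continuous_on S \<phi>"
    by (meson continuous_at_imp_continuous_on has_derivative_continuous)
  moreover have "((\<lambda>z. exp (- lam * snd z) * (\<phi> z + k)) has_derivative
      (\<lambda>h. (exp (- lam * snd z) *\<^sub>R g z - (0, lam * exp (- lam * snd z) * (\<phi> z + k))) \<bullet> h)) (at z)"
    if "z \<in> S" for z
    by (rule derivative_eq_intros d[OF that] refl | simp)+
       (auto simp: fun_eq_iff inner_diff_left inner_add_left algebra_simps)
  ultimately show ?thesis
    using assms unfolding C1_with_grad_def by (auto intro!: continuous_intros)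
qed

lemma viscosity_solution_exp_transform:
  fixes u :: "'a::euclidean_space \<Rightarrow> real \<Rightarrow> real"
  assumes "viscosity_solution T lam H0 u0 u"
  defines "H \<equiv> \<lambda>x t p. exp (lam * t) * H0 x t (exp (- lam * t) *\<^sub>R p)"
    and "v \<equiv> \<lambda>x t. exp (lam * t) * u x t"
  shows "viscosity_sub T H v" and "viscosity_super T H v"
proof -
  note vs = assms(1)[unfolded viscosity_solution_def, THEN conjunct2, THEN conjunct2, rule_format]
  have gen: "snd (exp (- lam * t) *\<^sub>R g (x, t) - (0, lam * exp (- lam * t) * (\<phi> (x, t) + (v x t - \<phi> (x, t)))))
      + lam * u x t + H0 x t (fst (exp (- lam * t) *\<^sub>R g (x, t) - (0, lam * exp (- lam * t) * (\<phi> (x, t) + (v x t - \<phi> (x, t))))))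
    = exp (- lam * t) * (snd (g (x, t)) + H x t (fst (g (x, t))))" for g :: "'a \<times> real \<Rightarrow> 'a \<times> real" and \<phi> x t
    by (simp add: H_def v_def exp_minus field_simps)
  have u: "u y s = exp (- lam * s) * v y s" for y s by (simp add: v_def exp_minus)
  show "viscosity_sub T H v"
    unfolding viscosity_sub_def
  proof (intro allI impI)
    fix \<phi> :: "'a \<times> real \<Rightarrow> real" and g x t
    assume \<phi>: "C1_with_grad (UNIV \<times> {0<..<T}) \<phi> g" and t: "0 < t" "t < T"
    assume "\<exists>e>0. \<forall>y s. dist (y, s) (x, t) < e \<and> 0 < s \<and> s < T \<longrightarrow> v y s - \<phi> (y, s) \<le> v x t - \<phi> (x, t)"
    then obtain e where e: "e > 0" "\<And>y s. dist (y, s) (x, t) < e \<Longrightarrow> 0 < s \<Longrightarrow> s < T \<Longrightarrow> v y s - \<phi> (y, s) \<le> v x t - \<phi> (x, t)"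
      by blast
    \<comment> \<open>With this constant \<phi> + k equals v at (x,t). The resulting inequality v
      \<le> \<phi> + k survives multiplication by the time-dependent factor, which an inequality
      between differences would not.\<close>
    define k where "k = v x t - \<phi> (x, t)"
    have "\<exists>e>0. \<forall>y s. dist (y, s) (x, t) < e \<and> 0 < s \<and> s < T \<longrightarrow>
        u y s - exp (- lam * snd (y, s)) * (\<phi> (y, s) + k) \<le> u x t - exp (- lam * snd (x, t)) * (\<phi> (x, t) + k)"
    proof (intro exI conjI allI impI)
      fix y s assume "dist (y, s) (x, t) < e \<and> 0 < s \<and> s < T"
      then have "v y s \<le> \<phi> (y, s) + k" using e(2)[of y s] by (simp add: k_def)
      then show "u y s - exp (- lam * snd (y, s)) * (\<phi> (y, s) + k) \<le> u x t - exp (- lam * snd (x, t)) * (\<phi> (x, t) + k)"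
        by (simp add: u k_def mult_left_mono)
    qed (rule e)
    with vs[OF conjI[OF C1_with_grad_exp_time[OF \<phi>, of lam k] conjI[OF t]], of x] gen[of t g x \<phi>]
    have "exp (- lam * t) * (snd (g (x, t)) + H x t (fst (g (x, t)))) \<le> 0" by (simp add: k_def)
    then show "snd (g (x, t)) + H x t (fst (g (x, t))) \<le> 0" by (simp add: mult_le_0_iff)
  qed
  show "viscosity_super T H v"
    unfolding viscosity_super_def
  proof (intro allI impI)
    fix \<phi> :: "'a \<times> real \<Rightarrow> real" and g x t
    assume \<phi>: "C1_with_grad (UNIV \<times> {0<..<T}) \<phi> g" and t: "0 < t" "t < T"
    assume "\<exists>e>0. \<forall>y s. dist (y, s) (x, t) < e \<and> 0 < s \<and> s < T \<longrightarrow> v x t - \<phi> (x, t) \<le> v y s - \<phi> (y, s)"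
    then obtain e where e: "e > 0" "\<And>y s. dist (y, s) (x, t) < e \<Longrightarrow> 0 < s \<Longrightarrow> s < T \<Longrightarrow> v x t - \<phi> (x, t) \<le> v y s - \<phi> (y, s)"
      by blast
    define k where "k = v x t - \<phi> (x, t)"
    have "\<exists>e>0. \<forall>y s. dist (y, s) (x, t) < e \<and> 0 < s \<and> s < T \<longrightarrow>
        u x t - exp (- lam * snd (x, t)) * (\<phi> (x, t) + k) \<le> u y s - exp (- lam * snd (y, s)) * (\<phi> (y, s) + k)"
    proof (intro exI conjI allI impI)
      fix y s assume "dist (y, s) (x, t) < e \<and> 0 < s \<and> s < T"
      then have "\<phi> (y, s) + k \<le> v y s" using e(2)[of y s] by (simp add: k_def)
      then show "u x t - exp (- lam * snd (x, t)) * (\<phi> (x, t) + k) \<le> u y s - exp (- lam * snd (y, s)) * (\<phi> (y, s) + k)"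
        by (simp add: u k_def mult_left_mono)
    qed (rule e)
    with vs[OF conjI[OF C1_with_grad_exp_time[OF \<phi>, of lam k] conjI[OF t]], of x] gen[of t g x \<phi>]
    have "0 \<le> exp (- lam * t) * (snd (g (x, t)) + H x t (fst (g (x, t))))" by (simp add: k_def)
    then show "0 \<le> snd (g (x, t)) + H x t (fst (g (x, t)))" by (simp add: zero_le_mult_iff)
  qed
qed

text \<open>The infimum over the ball is antitone in \<delta>, so its limit at 0 from the right is
  the supremum over \<delta> > 0. This proves that the limit exists and gives \<open>Lim\<close> its
  value.\<close>

lemma less_I_lower:
  fixes x :: "'a::euclidean_space"
  assumes "m < I_lower A B x t u0"
  obtains \<delta> where "\<delta> > 0" "\<And>y p. dist y x \<le> Rfun A B x t + \<delta> \<Longrightarrow> p \<in> subdiff u0 y \<Longrightarrow> m \<le> ereal (norm p)"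
proof -
  define F where "F \<delta> = (INF y\<in>cball x (Rfun A B x t + \<delta>). INF p\<in>subdiff u0 y. ereal (norm p))" for \<delta>
  have anti: "F \<delta>' \<le> F \<delta>" if "\<delta> \<le> \<delta>'" for \<delta> \<delta>'
    unfolding F_def using that by (intro INF_superset_mono subset_cball) auto
  have "(F \<longlongrightarrow> (SUP \<delta>\<in>{0<..}. F \<delta>)) (at_right 0)"
  proof (rule order_tendstoI)
    fix a assume "a < (SUP \<delta>\<in>{0<..}. F \<delta>)"
    then obtain \<delta> where \<delta>: "\<delta> > 0" "a < F \<delta>" by (auto simp: less_SUP_iff)
    have "\<forall>\<^sub>F d in at_right 0. d < \<delta>" using \<delta>(1) by (intro eventually_at_rightI[of 0 \<delta>]) auto
    then show "\<forall>\<^sub>F d in at_right 0. a < F d"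
      by eventually_elim (use anti \<delta>(2) less_le_trans less_imp_le in metis)
  next
    fix a assume a: "(SUP \<delta>\<in>{0<..}. F \<delta>) < a"
    have "\<forall>\<^sub>F d in at_right 0. d > (0::real)" by (simp add: eventually_at_right_less)
    then show "\<forall>\<^sub>F d in at_right 0. F d < a"
    proof eventually_elim
      case (elim d)
      then have "F d \<le> (SUP \<delta>\<in>{0<..}. F \<delta>)" by (intro SUP_upper) auto
      then show ?case using a by simp
    qed
  qed
  then have "I_lower A B x t u0 = (SUP \<delta>\<in>{0<..}. F \<delta>)"
    unfolding I_lower_def F_def by (intro tendsto_Lim) auto
  then obtain \<delta> where \<delta>: "\<delta> > 0" "m < F \<delta>" using assms by (auto simp: less_SUP_iff)
  show ?thesis
  proof (rule that[OF \<delta>(1)])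
    fix y p assume "dist y x \<le> Rfun A B x t + \<delta>" and p: "p \<in> subdiff u0 y"
    then have "F \<delta> \<le> (INF p\<in>subdiff u0 y. ereal (norm p))"
      unfolding F_def by (intro INF_lower) (simp add: dist_commute)
    also have "\<dots> \<le> ereal (norm p)" using p by (rule INF_lower)
    finally show "m \<le> ereal (norm p)" using \<delta>(2) by simp
  qed
qed

text \<open>Slope propagation works with real \<eta> \<ge> 0 below I. A violation of the claim would
  place (N + D)/K, which is nonnegative, strictly below I. If I is infinite, \<eta> = (N + D + 1)/K
  contradicts the assumption.\<close>

lemma ereal_bound_from_reals_below:
  fixes I :: ereal and K D N :: real
  assumes K: "K > 0" and D: "D \<ge> 0" and N: "N \<ge> 0"
    and le: "\<And>\<eta>. 0 \<le> \<eta> \<Longrightarrow> ereal \<eta> < I \<Longrightarrow> \<eta> * K - D \<le> N"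
  shows "I * ereal K - ereal D \<le> ereal N"
proof (cases I)
  case (real i)
  have "i * K - D \<le> N"
  proof (rule ccontr)
    assume neg: "\<not> i * K - D \<le> N"
    define m where "m = (N + D) / K"
    define \<eta> where "\<eta> = (i + m) / 2"
    have i: "m < i" using neg K by (simp add: m_def field_simps)
    have "0 \<le> m" using K D N by (simp add: m_def)
    then have "0 \<le> \<eta>" "\<eta> < i" "m < \<eta>" using i by (auto simp: \<eta>_def)
    moreover from this(3) have "N + D < \<eta> * K" using K by (simp add: m_def pos_divide_less_eq)
    ultimately show False using le[of \<eta>] real by simp
  qed
  then show ?thesis using real by simp
next
  case PInf
  have "((N + D + 1) / K) * K - D \<le> N" using K D N PInf by (intro le) auto
  then show ?thesis using K by simp
next
  case MInf
  then show ?thesis using K by simp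
qed

text \<open>The test function is used on the slice of constant time only, where its increment is p .
  (y - x) up to \<epsilon>|y - x|, and Cauchy-Schwarz applies.\<close>

lemma subdiff_x_lower_slope:
  fixes u :: "'a::euclidean_space \<Rightarrow> real \<Rightarrow> real"
  assumes p: "p \<in> subdiff_x u x t" and \<epsilon>: "\<epsilon> > 0"
  obtains \<rho> where "\<rho> > 0" "\<And>y. dist y x < \<rho> \<Longrightarrow> u x t - (norm p + \<epsilon>) * dist y x \<le> u y t"
proof -
  obtain \<phi> g \<tau> e where C1: "C1_with_grad UNIV \<phi> g" and g: "g (x, t) = (p, \<tau>)" and e: "e > 0"
    and min: "\<And>w. dist w (x, t) < e \<Longrightarrow> u x t - \<phi> (x, t) \<le> (case w of (y, s) \<Rightarrow> u y s) - \<phi> w"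
    using p unfolding subdiff_x_def subdiff_def by auto metis
  have "(\<phi> has_derivative (\<lambda>h. g (x, t) \<bullet> h)) (at (x, t))"
    using C1 by (simp add: C1_with_grad_def)
  then obtain d where d: "d > 0" "\<And>w. norm (w - (x, t)) < d \<Longrightarrow>
      norm (\<phi> w - \<phi> (x, t) - g (x, t) \<bullet> (w - (x, t))) \<le> \<epsilon> * norm (w - (x, t))"
    using \<epsilon> unfolding has_derivative_at_alt by blast
  show ?thesis
  proof (rule that[of "min d e"])
    show "min d e > 0" using d e by simp
    fix y assume y: "dist y x < min d e"
    have n: "norm ((y, t) - (x, t)) = dist y x" by (simp add: norm_Pair dist_norm)
    have "dist (y, t) (x, t) = dist y x" by (simp add: dist_Pair_Pair)
    then have 1: "u x t - \<phi> (x, t) \<le> u y t - \<phi> (y, t)" using min[of "(y, t)"] y by simp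
    have "\<bar>\<phi> (y, t) - \<phi> (x, t) - p \<bullet> (y - x)\<bar> \<le> \<epsilon> * dist y x"
      using d(2)[of "(y, t)"] y n by (simp add: g)
    moreover have "- (p \<bullet> (y - x)) \<le> norm p * dist y x"
      using Cauchy_Schwarz_ineq2[of p "y - x"] by (simp add: dist_norm abs_le_iff)
    ultimately have "\<phi> (y, t) - \<phi> (x, t) \<ge> - ((norm p + \<epsilon>) * dist y x)"
      by (simp add: abs_le_iff algebra_simps)
    then show "u x t - (norm p + \<epsilon>) * dist y x \<le> u y t" using 1 by simp
  qed
qed

text \<open>Both cases of the theorem at once: after the exponential change of unknown b(s) e^(C1 s)
  = \<beta> e^((C1 + lam) s), and \<open>J\<close> stands for the primitive of e^((C1 + lam) s)
  vanishing at 0.\<close>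

lemma subdiff_x_lower_bound:
  fixes T lam C1 \<beta> A2 B2 :: real
    and H0 :: "'a::euclidean_space \<Rightarrow> real \<Rightarrow> 'a \<Rightarrow> real"
    and u0 :: "'a \<Rightarrow> real" and u :: "'a \<Rightarrow> real \<Rightarrow> real"
  assumes u0_lip: "L-lipschitz_on UNIV u0"
    and H0_cont: "continuous_on (UNIV \<times> {0..T} \<times> UNIV) (\<lambda>(x, t, p). H0 x t p)"
    and C1_nonneg: "C1 \<ge> 0" and beta: "\<beta> \<ge> 0"
    and H0_lip_x: "\<And>x y t p. t \<in> {0..T} \<Longrightarrow>
        \<bar>H0 x t p - H0 y t p\<bar> \<le> C1 * (\<beta> + norm p) * dist x y"
    and A2_nonneg: "A2 \<ge> 0" and B2_nonneg: "B2 \<ge> 0"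
    and H0_lip_p: "\<And>x t p q. t \<in> {0..T} \<Longrightarrow>
        \<bar>H0 x t p - H0 x t q\<bar> \<le> (A2 * norm x + B2) * dist p q"
    and H0_convex: "\<And>x t. t \<in> {0..T} \<Longrightarrow> convex_on UNIV (H0 x t)"
    and visc: "viscosity_solution T lam H0 u0 u"
    and t: "0 < t" "t < T" and p: "p \<in> subdiff_x u x t"
    and J: "J 0 = 0" "\<And>s. (J has_real_derivative exp ((C1 + lam) * s)) (at s)"
  shows "I_lower A2 B2 x t u0 * ereal (exp (- (C1 + lam) * t))
      - ereal (C1 * \<beta> * exp (- (C1 + lam) * t) * J t) \<le> ereal (norm p)"
proof (rule ereal_bound_from_reals_below)
  have "J 0 \<le> J t"
    using t J(2) by (intro DERIV_nonneg_imp_nondecreasing[of 0 t J]) (auto intro!: exI)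
  then show "0 \<le> C1 * \<beta> * exp (- (C1 + lam) * t) * J t"
    using J(1) C1_nonneg beta by simp
next
  fix \<eta> assume \<eta>: "0 \<le> \<eta>" "ereal \<eta> < I_lower A2 B2 x t u0"
  obtain \<delta> where \<delta>: "\<delta> > 0"
    "\<And>y p. dist y x \<le> Rfun A2 B2 x t + \<delta> \<Longrightarrow> p \<in> subdiff u0 y \<Longrightarrow> ereal \<eta> \<le> ereal (norm p)"
    using less_I_lower[OF \<eta>(2)] by blast
  define H where "H = (\<lambda>x t p. exp (lam * t) * H0 x t (exp (- lam * t) *\<^sub>R p))"
  define v where "v = (\<lambda>x t. exp (lam * t) * u x t)"
  define b where "b = (\<lambda>t. \<beta> * exp (lam * t))"
  have cu: "continuous_on (UNIV \<times> {0..<T}) (\<lambda>(x, t). u x t)" and u_init: "\<And>x. u x 0 = u0 x"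
    using visc by (auto simp: viscosity_solution_def)
  have v0: "(\<lambda>x. v x 0) = u0" by (simp add: v_def u_init)
  have Hcont: "continuous_on (UNIV \<times> {0..T} \<times> UNIV) (\<lambda>(x, t, p). H x t p)"
  proof -
    have "continuous_on (UNIV \<times> {0..T} \<times> UNIV) (\<lambda>z::'a \<times> real \<times> 'a.
        case (fst z, fst (snd z), exp (- lam * fst (snd z)) *\<^sub>R snd (snd z)) of (x, t, p) \<Rightarrow> H0 x t p)"
      by (rule continuous_on_compose2[OF H0_cont]) (auto intro!: continuous_intros)
    then show ?thesis
      unfolding H_def case_prod_unfold fst_conv snd_conv by (intro continuous_intros)
  qed
  have cv: "continuous_on (UNIV \<times> {0..<T}) (\<lambda>(x, t). v x t)"
    using cu unfolding v_def case_prod_unfold by (intro continuous_intros)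
  have Hx: "\<bar>H x t p - H y t p\<bar> \<le> C1 * (b t + norm p) * dist x y" if "t \<in> {0..T}" for x y t p
  proof -
    have "\<bar>H x t p - H y t p\<bar> = exp (lam * t) * \<bar>H0 x t (exp (- lam * t) *\<^sub>R p) - H0 y t (exp (- lam * t) *\<^sub>R p)\<bar>"
      by (simp add: H_def abs_mult flip: right_diff_distrib)
    also have "\<dots> \<le> exp (lam * t) * (C1 * (\<beta> + norm (exp (- lam * t) *\<^sub>R p)) * dist x y)"
      by (intro mult_left_mono H0_lip_x that) auto
    also have "\<dots> = C1 * (b t + norm p) * dist x y"
      by (simp add: b_def exp_minus field_simps)
    finally show ?thesis .
  qed
  have Hp: "\<bar>H x t p - H x t q\<bar> \<le> (A2 * norm x + B2) * dist p q" if "t \<in> {0..T}" for x t p q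
  proof -
    have "\<bar>H x t p - H x t q\<bar> = exp (lam * t) * \<bar>H0 x t (exp (- lam * t) *\<^sub>R p) - H0 x t (exp (- lam * t) *\<^sub>R q)\<bar>"
      by (simp add: H_def abs_mult flip: right_diff_distrib)
    also have "\<dots> \<le> exp (lam * t) * ((A2 * norm x + B2) * dist (exp (- lam * t) *\<^sub>R p) (exp (- lam * t) *\<^sub>R q))"
      by (intro mult_left_mono H0_lip_p that) auto
    also have "dist (exp (- lam * t) *\<^sub>R p) (exp (- lam * t) *\<^sub>R q) = exp (- lam * t) * dist p q"
      by (simp add: dist_norm flip: scaleR_diff_right)
    also have "exp (lam * t) * ((A2 * norm x + B2) * (exp (- lam * t) * dist p q)) = (A2 * norm x + B2) * dist p q"
      by (simp add: exp_minus)
    finally show ?thesis .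
  qed
  have Hconv: "convex_on UNIV (H x t)" if "t \<in> {0..T}" for x t
  proof (rule convex_onI)
    fix s :: real and q q' assume s: "0 < s" "s < 1"
    have "H0 x t ((1 - s) *\<^sub>R (exp (- lam * t) *\<^sub>R q) + s *\<^sub>R (exp (- lam * t) *\<^sub>R q'))
        \<le> (1 - s) * H0 x t (exp (- lam * t) *\<^sub>R q) + s * H0 x t (exp (- lam * t) *\<^sub>R q')"
      by (rule convex_onD[OF H0_convex[OF that]]) (use s in auto)
    then have "exp (lam * t) * H0 x t ((1 - s) *\<^sub>R (exp (- lam * t) *\<^sub>R q) + s *\<^sub>R (exp (- lam * t) *\<^sub>R q'))
        \<le> exp (lam * t) * ((1 - s) * H0 x t (exp (- lam * t) *\<^sub>R q) + s * H0 x t (exp (- lam * t) *\<^sub>R q'))"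
      by (intro mult_left_mono) auto
    moreover have "(1 - s) *\<^sub>R (exp (- lam * t) *\<^sub>R q) + s *\<^sub>R (exp (- lam * t) *\<^sub>R q')
       = exp (- lam * t) *\<^sub>R ((1 - s) *\<^sub>R q + s *\<^sub>R q')" by (simp add: scaleR_add_right mult.commute)
    ultimately show "H x t ((1 - s) *\<^sub>R q + s *\<^sub>R q') \<le> (1 - s) * H x t q + s * H x t q'"
      by (simp add: H_def algebra_simps)
  qed simp
  have slope: "\<exists>\<rho>>0. \<forall>y. dist y x < \<rho> \<longrightarrow> v x t - (exp (lam * t) * norm p + \<epsilon>) * dist y x \<le> v y t"
    if \<epsilon>: "\<epsilon> > 0" for \<epsilon>
  proof -
    obtain \<rho> where \<rho>: "\<rho> > 0" "\<And>y. dist y x < \<rho> \<Longrightarrow> u x t - (norm p + exp (- lam * t) * \<epsilon>) * dist y x \<le> u y t"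
      using subdiff_x_lower_slope[OF p, of "exp (- lam * t) * \<epsilon>"] \<epsilon> by auto
    have "v x t - (exp (lam * t) * norm p + \<epsilon>) * dist y x \<le> v y t" if "dist y x < \<rho>" for y
    proof -
      have "exp (lam * t) * (u x t - (norm p + exp (- lam * t) * \<epsilon>) * dist y x) \<le> exp (lam * t) * u y t"
        using \<rho>(2)[OF that] by (intro mult_left_mono) auto
      moreover have "exp (lam * t) * (u x t - (norm p + exp (- lam * t) * \<epsilon>) * dist y x)
          = v x t - (exp (lam * t) * norm p + \<epsilon>) * dist y x"
        by (simp add: v_def exp_minus field_simps)
      ultimately show ?thesis unfolding v_def by linarith
    qed
    then show ?thesis using \<rho>(1) by blast
  qed
  have bb: "b s \<le> \<beta> * exp (\<bar>lam\<bar> * T)" if "s \<in> {0..T}" for s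
  proof -
    have "lam * s \<le> \<bar>lam\<bar> * s" using that by (intro mult_right_mono) auto
    also have "\<dots> \<le> \<bar>lam\<bar> * T" using that by (intro mult_left_mono) auto
    finally show ?thesis using beta by (simp add: b_def mult_left_mono)
  qed
  have "exp (- C1 * t) * (\<eta> - C1 * (\<beta> * J t)) \<le> exp (lam * t) * norm p"
  proof (rule lower_slope_propagation[where u = v and H = H and b = b and L = L and T = T
        and J = "\<lambda>s. \<beta> * J s" and A = A2 and B = B2 and x = x and \<delta> = \<delta>
        and b' = "\<beta> * exp (\<bar>lam\<bar> * T)"])
    show "L-lipschitz_on UNIV (\<lambda>x. v x 0)" unfolding v0 by (rule u0_lip)
    show "\<eta> \<le> norm q" if "dist y x \<le> Rfun A2 B2 x t + \<delta>" "q \<in> subdiff (\<lambda>x. v x 0) y" for y q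
      using \<delta>(2)[OF that[unfolded v0]] by simp
    show "viscosity_sub T H v" "viscosity_super T H v"
      unfolding H_def v_def by (rule viscosity_solution_exp_transform[OF visc])+
    show "((\<lambda>s. \<beta> * J s) has_real_derivative b s * exp (C1 * s)) (at s)" for s
      by (rule DERIV_cong[OF DERIV_cmult[OF J(2)]]) (simp add: b_def algebra_simps exp_add)
  qed (use C1_nonneg beta A2_nonneg B2_nonneg t \<delta>(1) \<eta>(1) J(1) Hcont Hx Hp Hconv slope cv bb in \<open>simp_all add: b_def\<close>)
  then have "exp (- lam * t) * (exp (- C1 * t) * (\<eta> - C1 * (\<beta> * J t))) \<le> exp (- lam * t) * (exp (lam * t) * norm p)"
    by (intro mult_left_mono) auto
  then have "exp (- (C1 + lam) * t) * (\<eta> - C1 * (\<beta> * J t)) \<le> norm p"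
    by (simp add: exp_minus exp_add algebra_simps exp_diff divide_simps)
  then show "\<eta> * exp (- (C1 + lam) * t) - C1 * \<beta> * exp (- (C1 + lam) * t) * J t \<le> norm p"
    by (simp add: algebra_simps)
qed auto

theorem theorem6p2:
  fixes T lam C1 \<beta> A2 B2 :: real
    and H0 :: "'a::euclidean_space \<Rightarrow> real \<Rightarrow> 'a \<Rightarrow> real"
    and u0 :: "'a \<Rightarrow> real" and u :: "'a \<Rightarrow> real \<Rightarrow> real"
  assumes T_pos: "T > 0"
    and u0_lip: "\<exists>L. L-lipschitz_on UNIV u0"
    and H0_cont: "continuous_on (UNIV \<times> {0..T} \<times> UNIV) (\<lambda>(x, t, p). H0 x t p)"
    and C1_nonneg: "C1 \<ge> 0" and beta: "\<beta> \<in> {0, 1}"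
    and H0_lip_x: "\<And>x y t p. t \<in> {0..T} \<Longrightarrow>
        \<bar>H0 x t p - H0 y t p\<bar> \<le> C1 * (\<beta> + norm p) * dist x y"
    and A2_nonneg: "A2 \<ge> 0" and B2_nonneg: "B2 \<ge> 0"
    and H0_lip_p: "\<And>x t p q. t \<in> {0..T} \<Longrightarrow>
        \<bar>H0 x t p - H0 x t q\<bar> \<le> (A2 * norm x + B2) * dist p q"
    and H0_convex: "\<And>x t. t \<in> {0..T} \<Longrightarrow> convex_on UNIV (H0 x t)"
    and visc: "viscosity_solution T lam H0 u0 u"
  shows "\<forall>x t p. 0 < t \<and> t < T \<and> p \<in> subdiff_x u x t \<longrightarrow>
     (lam \<noteq> - C1 \<longrightarrow>
        ereal (norm p) \<ge> I_lower A2 B2 x t u0 * ereal (exp (- (C1 + lam) * t))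
           - ereal (C1 * \<beta> / (C1 + lam) * (1 - exp (- (C1 + lam) * t)))) \<and>
     (lam = - C1 \<longrightarrow>
        ereal (norm p) \<ge> I_lower A2 B2 x t u0 - ereal (C1 * \<beta> * t))"
proof (intro allI impI conjI; elim conjE)
  fix x t p
  assume t: "0 < t" "t < T" and p: "p \<in> subdiff_x u x t"
  obtain L where L: "L-lipschitz_on UNIV u0" using u0_lip by blast
  have beta': "\<beta> \<ge> 0" using beta by auto
  note core = subdiff_x_lower_bound[OF L H0_cont C1_nonneg beta' H0_lip_x A2_nonneg B2_nonneg
      H0_lip_p H0_convex visc t p]
  {
    assume "lam \<noteq> - C1"
    then have ne: "C1 + lam \<noteq> 0" by linarith
    have "I_lower A2 B2 x t u0 * ereal (exp (- (C1 + lam) * t))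
        - ereal (C1 * \<beta> * exp (- (C1 + lam) * t) * ((exp ((C1 + lam) * t) - 1) / (C1 + lam))) \<le> ereal (norm p)"
      \<comment> \<open>Here J(s) = (e^((C1 + lam) s) - 1) / (C1 + lam).\<close>
      by (rule core) (use ne in \<open>auto intro!: derivative_eq_intros\<close>)
    moreover have "C1 * \<beta> * exp (- (C1 + lam) * t) * ((exp ((C1 + lam) * t) - 1) / (C1 + lam))
        = C1 * \<beta> / (C1 + lam) * (1 - exp (- (C1 + lam) * t))"
    proof -
      have eq: "exp (- (C1 + lam) * t) * (exp ((C1 + lam) * t) - 1) = 1 - exp (- (C1 + lam) * t)"
        unfolding right_diff_distrib mult_minus_left exp_add[symmetric] by simp
      have "C1 * \<beta> * exp (- (C1 + lam) * t) * ((exp ((C1 + lam) * t) - 1) / (C1 + lam))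
          = C1 * \<beta> / (C1 + lam) * (exp (- (C1 + lam) * t) * (exp ((C1 + lam) * t) - 1))"
        by simp
      then show ?thesis unfolding eq .
    qed
    ultimately show "I_lower A2 B2 x t u0 * ereal (exp (- (C1 + lam) * t))
           - ereal (C1 * \<beta> / (C1 + lam) * (1 - exp (- (C1 + lam) * t))) \<le> ereal (norm p)"
      by (simp only:)
  next
    assume "lam = - C1"
    then have z: "C1 + lam = 0" by simp
    have "I_lower A2 B2 x t u0 * ereal (exp (- (C1 + lam) * t))
        - ereal (C1 * \<beta> * exp (- (C1 + lam) * t) * t) \<le> ereal (norm p)"
      \<comment> \<open>The integrand is constantly 1, so J(s) = s.\<close>
      by (rule core) (auto simp: z)
    then show "I_lower A2 B2 x t u0 - ereal (C1 * \<beta> * t) \<le> ereal (norm p)"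
      by (simp add: z flip: one_ereal_def)
  }
qed

end
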